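(* For every $\varepsilon > 0$ there exists $\delta > 0$ such that the following holds for all sufficiently large integers $n$. Let $A$ and $B$ be sets of real numbers with $|A| = |B| = n$, and let $\mathcal{L}$ be a finite family of distinct lines in $\mathbb{R}^2$ such that (i) the lines in $\mathcal{L}$ have at least $n^{\varepsilon}$ distinct slopes, and (ii) every line of $\mathcal{L}$ is parallel to at least $n^{\varepsilon}$ other lines of $\mathcal{L}$. Then at least one line $\ell \in \mathcal{L}$ satisfies $|\ell \cap (A \times B)| < n^{1-\delta}$.
   Context: $A \times B = \{(a,b) : a \in A, b \in B\} \subset \mathbb{R}^2$ is the grid. Two lines are parallel if they have the same slope. *)

theory Defs
  imports "HOL-Analysis.Analysis"
begin

definition is_line :: "(real \<times> real) set \<Rightarrow> bool" where
  "is_line L \<longleftrightarrow> (\<exists>a b c. (a, b) \<noteq> (0, 0) \<and> L = {(x, y). a * x + b * y = c})"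

definition parallel :: "(real \<times> real) set \<Rightarrow> (real \<times> real) set \<Rightarrow> bool" where
  "parallel L M \<longleftrightarrow> (\<exists>a b c d. (a, b) \<noteq> (0, 0) \<and>
      L = {(x, y). a * x + b * y = c} \<and> M = {(x, y). a * x + b * y = d})"

definition num_slopes :: "(real \<times> real) set set \<Rightarrow> nat" where
  "num_slopes \<L> = card ((\<lambda>L. {M \<in> \<L>. parallel L M}) ` \<L>)"

end

theory Submission
  imports Defs
begin

text \<open>If all lines were rich, pruning \<open>A\<close> and \<open>B\<close> to a core of large minimum degree would give a set
  \<open>A'\<close> on which the random walk \<open>x \<mapsto> (s x + d - d') / s'\<close>, driven by random lines \<open>(s, d)\<close> and \<open>(s', d')\<close>
  of the family, survives for a bounded number of steps with probability \<open>n\<close> to a small negative power.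
  Its end point then lies in a set of size at most \<open>n\<close>, so its collision probability is not much below \<open>1 / n\<close>.
  On the other hand, given the slopes, the end point of a walk of doubled length is \<open>X + s Y\<close> up to constants,
  with \<open>s\<close> uniform among \<open>K\<close> values and independent of \<open>X\<close> and \<open>Y\<close>. The cell decomposition proof of the
  Szemeredi--Trotter theorem for Cartesian products, with cells of equal mass, shows that this lowers the
  collision probability by a factor of order \<open>sqrt K\<close>. Since \<open>K\<close> is a power of \<open>n\<close>, after boundedly many
  doublings it drops below \<open>1 / n\<close> by a power of \<open>n\<close>.\<close>

section \<open>Collision counts and the Cauchy-Schwarz inequality\<close>

text \<open>Divided by the square of \<open>card J\<close>, this is the collision probability of
  \<open>g\<close> at two independent uniform points of \<open>J\<close>, that is, the squared l2
  norm of its distribution. Diagonal pairs are included.\<close>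

definition coll :: "'a set \<Rightarrow> ('a \<Rightarrow> 'b) \<Rightarrow> nat" where
  "coll J g = card {(i, j) \<in> J \<times> J. g i = g j}"

lemma coll_eq_sum:
  assumes "finite J"
  shows "coll J g = (\<Sum>z\<in>g ` J. (card {j \<in> J. g j = z})\<^sup>2)"
proof -
  have "{(i, j) \<in> J \<times> J. g i = g j} = (\<Union>z\<in>g ` J. {j \<in> J. g j = z} \<times> {j \<in> J. g j = z})"
    by auto
  moreover have "card (\<Union>z\<in>g ` J. {j \<in> J. g j = z} \<times> {j \<in> J. g j = z})
      = (\<Sum>z\<in>g ` J. card ({j \<in> J. g j = z} \<times> {j \<in> J. g j = z}))"
    by (rule card_UN_disjoint) (use assms in auto)
  ultimately show ?thesis
    by (simp add: coll_def card_cartesian_product power2_eq_square)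
qed

lemma card_eq_sum_fibres:
  assumes "finite J"
  shows "card J = (\<Sum>z\<in>g ` J. card {j \<in> J. g j = z})"
proof -
  have "J = (\<Union>z\<in>g ` J. {j \<in> J. g j = z})" by auto
  moreover have "card (\<Union>z\<in>g ` J. {j \<in> J. g j = z}) = (\<Sum>z\<in>g ` J. card {j \<in> J. g j = z})"
    by (rule card_UN_disjoint) (use assms in auto)
  ultimately show ?thesis by simp
qed

text \<open>Cauchy-Schwarz over the fibres of \<open>g\<close>: few values force many
  collisions.\<close>

lemma card_power2_le_coll:
  assumes "finite J"
  shows "(card J)\<^sup>2 \<le> card (g ` J) * coll J g"
proof -
  have "(\<Sum>z\<in>g ` J. real (card {j \<in> J. g j = z}))\<^sup>2
      \<le> (\<Sum>z\<in>g ` J. (real (card {j \<in> J. g j = z}))\<^sup>2) * card (g ` J)"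
    by (rule sum_squared_le_sum_of_squares)
  moreover have "(\<Sum>z\<in>g ` J. real (card {j \<in> J. g j = z})) = real (card J)"
    using card_eq_sum_fibres[OF assms, of g] by simp
  moreover have "(\<Sum>z\<in>g ` J. (real (card {j \<in> J. g j = z}))\<^sup>2) = real (coll J g)"
    using coll_eq_sum[OF assms, of g] by simp
  ultimately have "real ((card J)\<^sup>2) \<le> real (card (g ` J) * coll J g)"
    by (simp add: mult.commute)
  then show ?thesis by (simp only: of_nat_le_iff)
qed

text \<open>Cauchy-Schwarz inside each fibre of \<open>g\<close>, which meets at most
  \<open>N\<close> classes of \<open>h\<close>. In the application the fibres are lines and
  \<open>h\<close> records the cell of a point.\<close>

lemma coll_le_fibre_coll:
  assumes "finite J" and "\<And>z. card (h ` {j \<in> J. g j = z}) \<le> N"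
  shows "coll J g \<le> N * coll J (\<lambda>j. (g j, h j))"
proof -
  have "coll J g \<le> (\<Sum>z\<in>g ` J. N * coll {j \<in> J. g j = z} h)"
    unfolding coll_eq_sum[OF assms(1)]
  proof (rule sum_mono)
    fix z
    have "(card {j \<in> J. g j = z})\<^sup>2 \<le> card (h ` {j \<in> J. g j = z}) * coll {j \<in> J. g j = z} h"
      using assms(1) by (intro card_power2_le_coll) auto
    also have "\<dots> \<le> N * coll {j \<in> J. g j = z} h"
      using assms(2) by (rule mult_le_mono1)
    finally show "(card {j \<in> J. g j = z})\<^sup>2 \<le> N * coll {j \<in> J. g j = z} h" .
  qed
  also have "(\<Sum>z\<in>g ` J. N * coll {j \<in> J. g j = z} h)
      = N * (\<Sum>z\<in>g ` J. coll {j \<in> J. g j = z} h)"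
    by (simp add: sum_distrib_left)
  also have "(\<Sum>z\<in>g ` J. coll {j \<in> J. g j = z} h) = coll J (\<lambda>j. (g j, h j))"
  proof -
    let ?F = "\<lambda>z. {(i, j) \<in> {j \<in> J. g j = z} \<times> {j \<in> J. g j = z}. h i = h j}"
    have "finite (?F z)" for z
      by (rule finite_subset[of _ "J \<times> J"]) (use assms(1) in auto)
    then have "card (\<Union>z\<in>g ` J. ?F z) = (\<Sum>z\<in>g ` J. card (?F z))"
      by (intro card_UN_disjoint) (use assms(1) in auto)
    moreover have "(\<Union>z\<in>g ` J. ?F z) = {(i, j) \<in> J \<times> J. (g i, h i) = (g j, h j)}"
      by auto
    ultimately show ?thesis by (simp add: coll_def)
  qed
  finally show ?thesis .
qed

section \<open>Cells of equal mass\<close>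

text \<open>Measuring positions by the number of points strictly to the left makes cells monotone, and bounds the
  mass of a cell by \<open>H\<close> once its rightmost point, however heavy, is ignored.\<close>

definition mass_cell :: "'a set \<Rightarrow> ('a \<Rightarrow> real) \<Rightarrow> real \<Rightarrow> real \<Rightarrow> int" where
  "mass_cell I f H x = \<lfloor>card {i \<in> I. f i < x} / H\<rfloor>"

lemma mass_cell_mono:
  assumes "finite I" "H > 0" "x \<le> y"
  shows "mass_cell I f H x \<le> mass_cell I f H y"
proof -
  have "card {i \<in> I. f i < x} \<le> card {i \<in> I. f i < y}"
    using assms by (intro card_mono) auto
  then show ?thesis
    unfolding mass_cell_def using assms by (intro floor_mono divide_right_mono) auto
qed

lemma mass_cell_range:
  fixes h :: real
  assumes "finite I" "I \<noteq> {}" "h > 0"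
  shows "mass_cell I f (h * card I) x \<in> {0..\<lfloor>1 / h\<rfloor>}"
proof -
  have c: "card I > 0" using assms by (simp add: card_gt_0_iff)
  have "card {i \<in> I. f i < x} \<le> card I"
    using assms by (intro card_mono) auto
  then have "real (card {i \<in> I. f i < x}) / (h * card I) \<le> card I / (h * card I)"
    using assms by (intro divide_right_mono) auto
  also have "\<dots> = 1 / h" using c by simp
  finally show ?thesis
    unfolding mass_cell_def using assms by (auto intro: floor_mono)
qed

text \<open>Let \<open>x\<close> be the leftmost value taken on the counted set. The set lies
  between \<open>x\<close> and \<open>y\<close>, and the counts to the left of these two points
  differ by less than \<open>H\<close> because both have the same cell index. The strict
  \<open>f i < y\<close> leaves out a possible atom at \<open>y\<close>.\<close>

lemma card_mass_cell_below:
  assumes "finite I" "H > 0"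
  shows "real (card {i \<in> I. f i < y \<and> mass_cell I f H (f i) = mass_cell I f H y}) \<le> H"
proof (cases "{i \<in> I. f i < y \<and> mass_cell I f H (f i) = mass_cell I f H y} = {}")
  case True
  then show ?thesis using assms by (simp only: card.empty)
next
  case False
  let ?M = "{i \<in> I. f i < y \<and> mass_cell I f H (f i) = mass_cell I f H y}"
  have fin: "finite ?M" using assms by simp
  define x where "x = Min (f ` ?M)"
  have "x \<in> f ` ?M" unfolding x_def using False fin by (intro Min_in) auto
  then have x: "mass_cell I f H x = mass_cell I f H y" "x < y" by auto
  have le: "x \<le> f i" if "i \<in> ?M" for i
    unfolding x_def using fin that by (intro Min_le) auto
  let ?lo = "{i \<in> I. f i < x}"
  have disj: "?lo \<inter> ?M = {}" using le by force
  have "card ?lo + card ?M = card (?lo \<union> ?M)"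
    using disj assms fin by (intro card_Un_disjoint[symmetric]) auto
  also have "\<dots> \<le> card {i \<in> I. f i < y}"
    using x assms by (intro card_mono) auto
  finally have 1: "real (card ?lo) + real (card ?M) \<le> real (card {i \<in> I. f i < y})"
    by linarith
  have "real (card {i \<in> I. f i < y}) / H < real_of_int (mass_cell I f H y) + 1"
    unfolding mass_cell_def by linarith
  moreover have "real_of_int (mass_cell I f H y) \<le> real (card ?lo) / H"
    unfolding x(1)[symmetric] by (simp add: mass_cell_def)
  ultimately have "real (card {i \<in> I. f i < y}) / H < (real (card ?lo) + H) / H"
    using assms(2) by (simp add: add_divide_distrib)
  then have "real (card {i \<in> I. f i < y}) < real (card ?lo) + H"
    using assms(2) by (simp only: divide_less_cancel)
  with 1 show ?thesis by linarith
qed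

text \<open>Order each pair by its values of \<open>f\<close>: below the larger one its cell
  contains at most \<open>h * card I\<close> partners, and the factor 2 accounts for the two orders.
  Pairs of equal value are left out, as atoms of \<open>f\<close> may be arbitrarily heavy.\<close>

lemma card_offdiag_mass_cell:
  fixes f :: "'a \<Rightarrow> real" and h :: real
  assumes "finite I" "h > 0"
  defines "C \<equiv> mass_cell I f (h * card I)"
  shows "real (card {(i, i') \<in> I \<times> I. f i \<noteq> f i' \<and> C (f i) = C (f i')}) \<le> 2 * h * (card I)\<^sup>2"
proof (cases "I = {}")
  case True
  then show ?thesis by simp
next
  case False
  let ?R = "{(i', i). i' \<in> I \<and> i \<in> I \<and> f i < f i' \<and> C (f i) = C (f i')}"
  have finR: "finite ?R"
    by (rule finite_subset[of _ "I \<times> I"]) (use assms in auto)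
  have H: "h * card I > 0" using assms False by (simp add: card_gt_0_iff)
  have "?R = Sigma I (\<lambda>i'. {i \<in> I. f i < f i' \<and> C (f i) = C (f i')})" by auto
  then have "real (card ?R) = (\<Sum>i'\<in>I. real (card {i \<in> I. f i < f i' \<and> C (f i) = C (f i')}))"
    using assms(1) by simp
  also have "\<dots> \<le> (\<Sum>i'\<in>I. h * card I)"
    unfolding C_def using card_mass_cell_below[OF assms(1) H] by (intro sum_mono) auto
  also have "\<dots> = h * (card I)\<^sup>2" by (simp add: power2_eq_square)
  finally have R: "real (card ?R) \<le> h * (card I)\<^sup>2" .
  have "{(i, i') \<in> I \<times> I. f i \<noteq> f i' \<and> C (f i) = C (f i')} \<subseteq> ?R \<union> prod.swap ` ?R"
    by (auto simp: image_iff)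
  then have "card {(i, i') \<in> I \<times> I. f i \<noteq> f i' \<and> C (f i) = C (f i')} \<le> card (?R \<union> prod.swap ` ?R)"
    using finR by (intro card_mono) auto
  also have "\<dots> \<le> card ?R + card (prod.swap ` ?R)" by (rule card_Un_le)
  also have "\<dots> \<le> 2 * card ?R" using card_image_le[OF finR, of prod.swap] by simp
  finally show ?thesis using R by linarith
qed

section \<open>Lines and cells: the collision bound averaged over slopes\<close>

text \<open>Both cell indices are monotone along the line, so the cells met form a chain. For
  \<open>s > 0\<close> the indices move in opposite directions and their difference, a number in
  \<open>{- N..N}\<close>, identifies the cell; for \<open>s < 0\<close> their sum, in
  \<open>{0..2 * N}\<close>, does.\<close>

lemma card_cells_on_line:
  fixes f :: "'a \<Rightarrow> real" and g :: "'b \<Rightarrow> real" and cX cY :: "real \<Rightarrow> int"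
  assumes "finite P" "mono cX" "mono cY" "range cX \<subseteq> {0..N}" "range cY \<subseteq> {0..N}"
    and "s \<noteq> 0" and P: "\<And>i j. (i, j) \<in> P \<Longrightarrow> f i + s * g j = z"
  shows "card ((\<lambda>(i, j). (cX (f i), cY (g j))) ` P) \<le> nat (2 * N + 1)"
proof -
  let ?h = "\<lambda>(i, j). (cX (f i), cY (g j))"
  have r: "0 \<le> cX x" "cX x \<le> N" "0 \<le> cY x" "cY x \<le> N" for x
    using assms(4,5) by (auto simp: image_subset_iff)
  show ?thesis
  proof (cases "s > 0")
    case True
    have *: "cX (f i) = cX (f i') \<and> cY (g j) = cY (g j')"
      if "(i, j) \<in> P" "(i', j') \<in> P" "cX (f i) - cY (g j) = cX (f i') - cY (g j')" "f i \<le> f i'"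
      for i j i' j'
    proof -
      have "s * g j' \<le> s * g j" using P[OF that(1)] P[OF that(2)] that(4) by linarith
      then have "g j' \<le> g j" using True by simp
      then show ?thesis
        using that(3) monoD[OF assms(2) that(4)] monoD[OF assms(3), of "g j'" "g j"] by linarith
    qed
    have eq: "cX (f i) = cX (f i') \<and> cY (g j) = cY (g j')"
      if "(i, j) \<in> P" "(i', j') \<in> P" "cX (f i) - cY (g j) = cX (f i') - cY (g j')" for i j i' j'
    proof (cases "f i \<le> f i'")
      case True
      with that show ?thesis by (rule *)
    next
      case False
      then have "f i' \<le> f i" by linarith
      from *[OF that(2,1) that(3)[symmetric] this] show ?thesis by (simp only:)
    qed
    have "inj_on (\<lambda>(u, v). u - v) (?h ` P)"
    proof (rule inj_onI)
      fix c c'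
      assume "c \<in> ?h ` P" "c' \<in> ?h ` P" and e: "(\<lambda>(u, v). u - v) c = (\<lambda>(u, v). u - v) c'"
      then obtain i j i' j' where p: "(i, j) \<in> P" "(i', j') \<in> P"
        and c: "c = (cX (f i), cY (g j))" "c' = (cX (f i'), cY (g j'))"
        by fast
      show "c = c'" using eq[OF p] e unfolding c prod.case prod.inject .
    qed
    moreover have "(\<lambda>(u, v). u - v) ` ?h ` P \<subseteq> {- N..N}"
    proof clarify
      fix i j
      show "cX (f i) - cY (g j) \<in> {- N..N}" using r[of "f i"] r[of "g j"] by simp
    qed
    ultimately have "card (?h ` P) \<le> card {- N..N}"
      by (rule card_inj_on_le) simp
    then show ?thesis by (simp add: algebra_simps)
  next
    case False
    have *: "cX (f i) = cX (f i') \<and> cY (g j) = cY (g j')"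
      if "(i, j) \<in> P" "(i', j') \<in> P" "cX (f i) + cY (g j) = cX (f i') + cY (g j')" "f i \<le> f i'"
      for i j i' j'
    proof -
      have "s * g j' \<le> s * g j" using P[OF that(1)] P[OF that(2)] that(4) by linarith
      then have "g j \<le> g j'" using False assms(6) by (simp add: mult_le_cancel_left)
      then show ?thesis
        using that(3) monoD[OF assms(2) that(4)] monoD[OF assms(3), of "g j" "g j'"] by linarith
    qed
    have eq: "cX (f i) = cX (f i') \<and> cY (g j) = cY (g j')"
      if "(i, j) \<in> P" "(i', j') \<in> P" "cX (f i) + cY (g j) = cX (f i') + cY (g j')" for i j i' j'
    proof (cases "f i \<le> f i'")
      case True
      with that show ?thesis by (rule *)
    next
      case False
      then have "f i' \<le> f i" by linarith
      from *[OF that(2,1) that(3)[symmetric] this] show ?thesis by (simp only:)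
    qed
    have "inj_on (\<lambda>(u, v). u + v) (?h ` P)"
    proof (rule inj_onI)
      fix c c'
      assume "c \<in> ?h ` P" "c' \<in> ?h ` P" and e: "(\<lambda>(u, v). u + v) c = (\<lambda>(u, v). u + v) c'"
      then obtain i j i' j' where p: "(i, j) \<in> P" "(i', j') \<in> P"
        and c: "c = (cX (f i), cY (g j))" "c' = (cX (f i'), cY (g j'))"
        by fast
      show "c = c'" using eq[OF p] e unfolding c prod.case prod.inject .
    qed
    moreover have "(\<lambda>(u, v). u + v) ` ?h ` P \<subseteq> {0..2 * N}"
    proof clarify
      fix i j
      show "cX (f i) + cY (g j) \<in> {0..2 * N}" using r[of "f i"] r[of "g j"] by simp
    qed
    ultimately have "card (?h ` P) \<le> card {0..2 * N}"
      by (rule card_inj_on_le) simp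
    then show ?thesis by simp
  qed
qed

text \<open>The second summand counts pairs of distinct points in a common cell: each of them lies on at most
  one line with slope in \<open>S\<close>.\<close>

lemma sum_coll_cells_le:
  fixes f :: "'a \<Rightarrow> real" and g :: "'b \<Rightarrow> real" and cX cY :: "real \<Rightarrow> 'c"
  assumes "finite I" "finite J" "finite S" "0 \<notin> S"
  shows "(\<Sum>s\<in>S. coll (I \<times> J) (\<lambda>(i, j). (f i + s * g j, cX (f i), cY (g j))))
    \<le> card S * (coll I f * coll J g)
      + card {(i, i') \<in> I \<times> I. f i \<noteq> f i' \<and> cX (f i) = cX (f i')}
        * card {(j, j') \<in> J \<times> J. g j \<noteq> g j' \<and> cY (g j) = cY (g j')}"
proof -
  let ?DX = "{(i, i') \<in> I \<times> I. f i = f i'}" and ?DY = "{(j, j') \<in> J \<times> J. g j = g j'}"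
  let ?EX = "{(i, i') \<in> I \<times> I. f i \<noteq> f i' \<and> cX (f i) = cX (f i')}"
  let ?EY = "{(j, j') \<in> J \<times> J. g j \<noteq> g j' \<and> cY (g j) = cY (g j')}"
  let ?T = "{(s, (i, j), (i', j')). s \<in> S \<and> i \<in> I \<and> j \<in> J \<and> i' \<in> I \<and> j' \<in> J
      \<and> f i + s * g j = f i' + s * g j' \<and> cX (f i) = cX (f i') \<and> cY (g j) = cY (g j')}"
  let ?c = "\<lambda>s (i, j). (f i + s * g j, cX (f i), cY (g j))"
  let ?T1 = "{(s, (i, j), (i', j')). s \<in> S \<and> (i, i') \<in> ?DX \<and> (j, j') \<in> ?DY}"
  let ?T2 = "{(s, (i, j), (i', j')). s \<in> S \<and> (i, i') \<in> ?EX \<and> (j, j') \<in> ?EY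
      \<and> f i + s * g j = f i' + s * g j'}"
  have finDX: "finite ?DX" and finEX: "finite ?EX"
    by (rule finite_subset[of _ "I \<times> I"]; use assms in auto)+
  have finDY: "finite ?DY" and finEY: "finite ?EY"
    by (rule finite_subset[of _ "J \<times> J"]; use assms in auto)+
  have fin: "finite ?T1" "finite ?T2"
    by (rule finite_subset[of _ "S \<times> (I \<times> J) \<times> (I \<times> J)"], fast, use assms in simp)+
  have "(\<Sum>s\<in>S. coll (I \<times> J) (?c s)) = card (Sigma S (\<lambda>s. {(p, q) \<in> (I \<times> J) \<times> (I \<times> J). ?c s p = ?c s q}))"
    unfolding coll_def
  proof (rule card_SigmaI[symmetric, OF assms(3)], rule ballI)
    fix s
    show "finite {(p, q) \<in> (I \<times> J) \<times> (I \<times> J). ?c s p = ?c s q}"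
      by (rule finite_subset[where B = "(I \<times> J) \<times> (I \<times> J)"], fast, use assms in simp)
  qed
  also have "Sigma S (\<lambda>s. {(p, q) \<in> (I \<times> J) \<times> (I \<times> J). ?c s p = ?c s q}) = ?T"
  proof (rule set_eqI)
    fix x :: "real \<times> ('a \<times> 'b) \<times> 'a \<times> 'b"
    obtain s i j i' j' where x: "x = (s, (i, j), (i', j'))" by (metis prod.exhaust)
    show "x \<in> Sigma S (\<lambda>s. {(p, q) \<in> (I \<times> J) \<times> (I \<times> J). ?c s p = ?c s q}) \<longleftrightarrow> x \<in> ?T"
      unfolding x mem_Sigma_iff mem_Collect_eq prod.case prod.inject by blast
  qed
  \<comment> \<open>Because \<open>s \<noteq> 0\<close>, the values of \<open>f\<close> agree
    exactly when those of \<open>g\<close> do: a collision is diagonal in both coordinates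
    (\<open>?T1\<close>) or in neither (\<open>?T2\<close>).\<close>
  also have "?T \<subseteq> ?T1 \<union> ?T2"
  proof -
    have "f i = f i' \<longleftrightarrow> g j = g j'" if "s \<in> S" "f i + s * g j = f i' + s * g j'" for s i j i' j'
    proof -
      have "s \<noteq> 0" using assms(4) that(1) by metis
      then show ?thesis using that(2) by (metis add_left_cancel add_right_cancel mult_left_cancel)
    qed
    then show ?thesis by blast
  qed
  then have "card ?T \<le> card (?T1 \<union> ?T2)"
    using fin by (intro card_mono finite_UnI)
  also have "\<dots> \<le> card ?T1 + card ?T2" by (rule card_Un_le)
  also have "card ?T1 \<le> card (S \<times> ?DX \<times> ?DY)"
  proof (rule card_inj_on_le)
    show "inj_on (\<lambda>(s, (i, j), (i', j')). (s, (i, i'), (j, j'))) ?T1"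
      by (auto simp: inj_on_def)
  qed (use assms finDX finDY in auto)
  also have "card (S \<times> ?DX \<times> ?DY) = card S * (coll I f * coll J g)"
    by (simp add: card_cartesian_product coll_def)
  also have "card ?T2 \<le> card (?EX \<times> ?EY)"
  proof (rule card_inj_on_le)
    show "inj_on (\<lambda>(s, (i, j), (i', j')). ((i, i'), (j, j'))) ?T2"
    proof (rule inj_onI)
      fix x x'
      assume xx: "x \<in> ?T2" "x' \<in> ?T2"
        and e: "(\<lambda>(s, (i, j), (i', j')). ((i, i'), (j, j'))) x = (\<lambda>(s, (i, j), (i', j')). ((i, i'), (j, j'))) x'"
      obtain s i j i' j' where x: "x = (s, (i, j), (i', j'))" by (metis prod.exhaust)
      obtain t where x': "x' = (t, (i, j), (i', j'))" using e unfolding x by (cases x') auto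
      have "f i + s * g j = f i' + s * g j'" "f i + t * g j = f i' + t * g j'" "g j \<noteq> g j'"
        using xx unfolding x x' by blast+
      moreover from this have "(s - t) * (g j - g j') = 0" by (simp only: algebra_simps)
      ultimately show "x = x'" unfolding x x' by simp
    qed
    show "(\<lambda>(s, (i, j), (i', j')). ((i, i'), (j, j'))) ` ?T2 \<subseteq> ?EX \<times> ?EY"
      by (rule image_subsetI, clarify, blast)
  qed (use finEX finEY in simp)
  also have "card (?EX \<times> ?EY) = card ?EX * card ?EY" by (rule card_cartesian_product)
  finally show ?thesis by simp
qed

text \<open>Restricting to collisions in a common cell costs a factor \<open>3 / h\<close>, a bound
  for the number of cells met by a line. Diagonal collisions then recur for every slope, but each
  off-diagonal one occurs for a single slope at most; this is the gain from having many
  slopes.\<close>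

lemma sum_coll_le:
  fixes f :: "'a \<Rightarrow> real" and g :: "'b \<Rightarrow> real" and h :: real
  assumes fin: "finite I" "finite J" "finite S" and "0 \<notin> S" and h: "0 < h" "h \<le> 1"
  shows "(\<Sum>s\<in>S. real (coll (I \<times> J) (\<lambda>(i, j). f i + s * g j)))
    \<le> 3 / h * (real (card S) * (coll I f * coll J g) + 4 * h\<^sup>2 * (card I)\<^sup>2 * (card J)\<^sup>2)"
proof (cases "I = {} \<or> J = {}")
  case True
  then show ?thesis by (auto simp: coll_def)
next
  case False
  define cX where "cX = mass_cell I f (h * card I)"
  define cY where "cY = mass_cell J g (h * card J)"
  define N where "N = \<lfloor>1 / h\<rfloor>"
  have pos: "h * card I > 0" "h * card J > 0"
    using False fin h by (auto simp: card_gt_0_iff)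
  have m: "mono cX" "mono cY"
    unfolding cX_def cY_def using pos fin by (auto intro!: monoI mass_cell_mono)
  have r: "range cX \<subseteq> {0..N}" "range cY \<subseteq> {0..N}"
    unfolding cX_def cY_def N_def using False fin h
    using mass_cell_range[of I h f] mass_cell_range[of J h g] by blast+
  \<comment> \<open>The hypothesis \<open>h \<le> 1\<close> lets the extra 1 in
    \<open>2 * N + 1\<close> be absorbed into \<open>3 / h\<close>.\<close>
  have "1 \<le> 1 / h" using h by simp
  moreover have "N \<le> 1 / h" "0 \<le> N" unfolding N_def using h by auto
  ultimately have N: "real (nat (2 * N + 1)) \<le> 3 / h" by simp
  have "coll (I \<times> J) (\<lambda>(i, j). f i + s * g j)
      \<le> nat (2 * N + 1) * coll (I \<times> J) (\<lambda>(i, j). (f i + s * g j, cX (f i), cY (g j)))" if "s \<in> S" for s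
  proof -
    have "card ((\<lambda>(i, j). (cX (f i), cY (g j))) ` {p \<in> I \<times> J. (\<lambda>(i, j). f i + s * g j) p = z}) \<le> nat (2 * N + 1)" for z
      by (rule card_cells_on_line[where s = s and z = z]) (use m r fin that assms(4) in auto)
    then have "coll (I \<times> J) (\<lambda>(i, j). f i + s * g j)
      \<le> nat (2 * N + 1) * coll (I \<times> J) (\<lambda>p. ((\<lambda>(i, j). f i + s * g j) p, (\<lambda>(i, j). (cX (f i), cY (g j))) p))"
      using fin by (intro coll_le_fibre_coll) auto
    moreover have "(\<lambda>p. ((\<lambda>(i, j). f i + s * g j) p, (\<lambda>(i, j). (cX (f i), cY (g j))) p))
       = (\<lambda>(i, j). (f i + s * g j, cX (f i), cY (g j)))"
      by auto
    ultimately show ?thesis by simp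
  qed
  then have "(\<Sum>s\<in>S. coll (I \<times> J) (\<lambda>(i, j). f i + s * g j))
      \<le> (\<Sum>s\<in>S. nat (2 * N + 1) * coll (I \<times> J) (\<lambda>(i, j). (f i + s * g j, cX (f i), cY (g j))))"
    by (rule sum_mono)
  also have "\<dots> = nat (2 * N + 1) * (\<Sum>s\<in>S. coll (I \<times> J) (\<lambda>(i, j). (f i + s * g j, cX (f i), cY (g j))))"
    by (simp add: sum_distrib_left)
  also have "\<dots> \<le> nat (2 * N + 1) * (card S * (coll I f * coll J g)
      + card {(i, i') \<in> I \<times> I. f i \<noteq> f i' \<and> cX (f i) = cX (f i')}
        * card {(j, j') \<in> J \<times> J. g j \<noteq> g j' \<and> cY (g j) = cY (g j')})" (is "_ \<le> _ * (_ + ?EX * ?EY)")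
    using assms by (intro mult_le_mono2 sum_coll_cells_le) auto
  finally have "real (\<Sum>s\<in>S. coll (I \<times> J) (\<lambda>(i, j). f i + s * g j))
      \<le> real (nat (2 * N + 1) * (card S * (coll I f * coll J g) + ?EX * ?EY))"
    by (simp only: of_nat_le_iff)
  also have "\<dots> = real (nat (2 * N + 1)) * (real (card S) * (coll I f * coll J g) + real ?EX * real ?EY)"
    by simp
  also have "\<dots> \<le> 3 / h * (real (card S) * (coll I f * coll J g)
      + (2 * h * (card I)\<^sup>2) * (2 * h * (card J)\<^sup>2))"
  proof (rule mult_mono[OF N])
    have "real ?EX * real ?EY \<le> (2 * h * (card I)\<^sup>2) * (2 * h * (card J)\<^sup>2)"
      using card_offdiag_mass_cell[OF fin(1) h(1), of f, folded cX_def]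
        card_offdiag_mass_cell[OF fin(2) h(1), of g, folded cY_def] h
      by (intro mult_mono) auto
    then show "real (card S) * (coll I f * coll J g) + real ?EX * real ?EY
      \<le> real (card S) * (coll I f * coll J g) + (2 * h * (card I)\<^sup>2) * (2 * h * (card J)\<^sup>2)"
      by (rule add_left_mono)
  qed (use h in simp_all)
  finally show ?thesis by (simp add: power2_eq_square mult_ac)
qed

section \<open>Pruning to a core of large minimum degree\<close>

text \<open>View the pairs \<open>(x, a)\<close> with \<open>f x a\<close> in \<open>B\<close> as
  edges of a bipartite multigraph. Deleting a vertex of degree below \<open>\<kappa>\<close> loses
  fewer than \<open>\<kappa>\<close> edges, so the strict edge bound is inherited and the deletion
  stops before the edges run out.\<close>

lemma min_degree_core:
  fixes f :: "'x \<Rightarrow> 'a \<Rightarrow> 'b" and \<kappa> :: real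
  assumes "finite X" "finite A" "finite B" and inj: "\<And>x. x \<in> X \<Longrightarrow> inj (f x)" and "\<kappa> \<ge> 0"
    and "\<kappa> * (card A + card B) < card {(x, a) \<in> X \<times> A. f x a \<in> B}"
  shows "\<exists>A' B'. A' \<subseteq> A \<and> B' \<subseteq> B \<and> A' \<noteq> {} \<and>
    (\<forall>a\<in>A'. \<kappa> \<le> card {x \<in> X. f x a \<in> B'}) \<and> (\<forall>b\<in>B'. \<kappa> \<le> card {x \<in> X. b \<in> f x ` A'})"
  using assms(2,3,6)
proof (induction "card A + card B" arbitrary: A B rule: less_induct)
  case less
  consider (a) a where "a \<in> A" "card {x \<in> X. f x a \<in> B} < \<kappa>"
    | (b) b where "b \<in> B" "card {x \<in> X. b \<in> f x ` A} < \<kappa>"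
    | (c) "\<forall>a\<in>A. \<kappa> \<le> card {x \<in> X. f x a \<in> B}" "\<forall>b\<in>B. \<kappa> \<le> card {x \<in> X. b \<in> f x ` A}"
    using not_le by blast
  then show ?case
  proof cases
    case a
    let ?E = "{(x, a') \<in> X \<times> (A - {a}). f x a' \<in> B}" and ?D = "{x \<in> X. f x a \<in> B}"
    have "{(x, a) \<in> X \<times> A. f x a \<in> B} \<subseteq> ?E \<union> (\<lambda>x. (x, a)) ` ?D" by auto
    moreover have "finite (?E \<union> (\<lambda>x. (x, a)) ` ?D)"
      by (rule finite_subset[of _ "X \<times> A"]) (use less.prems assms(1) a in auto)
    ultimately have "card {(x, a) \<in> X \<times> A. f x a \<in> B} \<le> card (?E \<union> (\<lambda>x. (x, a)) ` ?D)"
      by (intro card_mono)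
    also have "\<dots> \<le> card ?E + card ?D"
      using card_Un_le[of ?E "(\<lambda>x. (x, a)) ` ?D"] card_image_le[of ?D "\<lambda>x. (x, a)"] assms(1) by simp
    finally have 1: "real (card {(x, a) \<in> X \<times> A. f x a \<in> B}) \<le> card ?E + card ?D"
      by linarith
    have 2: "card A = Suc (card (A - {a}))" using a less.prems by (metis card.remove)
    have E: "\<kappa> * (card (A - {a}) + card B) < card ?E"
    proof -
      have "\<kappa> * (card A + card B) = \<kappa> * (card (A - {a}) + card B) + \<kappa>"
        by (simp only: 2) (simp add: algebra_simps)
      with 1 a(2) less.prems(3) show ?thesis by linarith
    qed
    obtain A' B' where "A' \<subseteq> A - {a}" "B' \<subseteq> B" "A' \<noteq> {}"
      "\<forall>a\<in>A'. \<kappa> \<le> card {x \<in> X. f x a \<in> B'}" "\<forall>b\<in>B'. \<kappa> \<le> card {x \<in> X. b \<in> f x ` A'}"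
    proof -
      have "\<exists>A' B'. A' \<subseteq> A - {a} \<and> B' \<subseteq> B \<and> A' \<noteq> {} \<and>
        (\<forall>a\<in>A'. \<kappa> \<le> card {x \<in> X. f x a \<in> B'}) \<and> (\<forall>b\<in>B'. \<kappa> \<le> card {x \<in> X. b \<in> f x ` A'})"
        using 2 by (intro less.hyps[OF _ finite_Diff[OF less.prems(1)] less.prems(2) E]) linarith
      then show ?thesis using that by blast
    qed
    then show ?thesis by (intro exI[of _ A'] exI[of _ B']) (simp add: subset_Diff_insert)
  next
    case b
    let ?E = "{(x, a) \<in> X \<times> A. f x a \<in> B - {b}}" and ?D = "{x \<in> X. b \<in> f x ` A}"
    let ?F = "{(x, a) \<in> X \<times> A. f x a = b}"
    have finF: "finite ?F" by (rule finite_subset[of _ "X \<times> A"]) (use less.prems assms(1) in auto)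
    have "{(x, a) \<in> X \<times> A. f x a \<in> B} \<subseteq> ?E \<union> ?F" by auto
    moreover have "finite (?E \<union> ?F)"
      by (rule finite_subset[of _ "X \<times> A"]) (use less.prems assms(1) in auto)
    ultimately have "card {(x, a) \<in> X \<times> A. f x a \<in> B} \<le> card (?E \<union> ?F)"
      by (intro card_mono)
    also have "\<dots> \<le> card ?E + card ?F" by (rule card_Un_le)
    \<comment> \<open>Injectivity of \<open>f x\<close> gives each \<open>x\<close> at most one edge
      at \<open>b\<close>, so the degree of \<open>b\<close> bounds the number of lost
      edges.\<close>
    also have "card ?F \<le> card ?D"
    proof (rule card_inj_on_le)
      show "inj_on fst ?F" using inj by (auto simp: inj_on_def)
    qed (use assms(1) in auto)
    finally have 1: "real (card {(x, a) \<in> X \<times> A. f x a \<in> B}) \<le> card ?E + card ?D"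
      by simp
    have 2: "card B = Suc (card (B - {b}))" using b less.prems by (metis card.remove)
    have E: "\<kappa> * (card A + card (B - {b})) < card ?E"
    proof -
      have "\<kappa> * (card A + card B) = \<kappa> * (card A + card (B - {b})) + \<kappa>"
        by (simp only: 2) (simp add: algebra_simps)
      with 1 b(2) less.prems(3) show ?thesis by linarith
    qed
    obtain A' B' where "A' \<subseteq> A" "B' \<subseteq> B - {b}" "A' \<noteq> {}"
      "\<forall>a\<in>A'. \<kappa> \<le> card {x \<in> X. f x a \<in> B'}" "\<forall>b\<in>B'. \<kappa> \<le> card {x \<in> X. b \<in> f x ` A'}"
    proof -
      have "\<exists>A' B'. A' \<subseteq> A \<and> B' \<subseteq> B - {b} \<and> A' \<noteq> {} \<and>
        (\<forall>a\<in>A'. \<kappa> \<le> card {x \<in> X. f x a \<in> B'}) \<and> (\<forall>b\<in>B'. \<kappa> \<le> card {x \<in> X. b \<in> f x ` A'})"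
        using 2 by (intro less.hyps[OF _ less.prems(1) finite_Diff[OF less.prems(2)] E]) linarith
      then show ?thesis using that by blast
    qed
    then show ?thesis by (intro exI[of _ A'] exI[of _ B']) (simp add: subset_Diff_insert)
  next
    case c
    have "A \<noteq> {}"
    proof
      assume A: "A = {}"
      have "0 \<le> \<kappa> * (card A + card B)" using assms(5) by simp
      also have "\<dots> < 0" using less.prems(3) by (simp add: A)
      finally show False by simp
    qed
    with c show ?thesis by blast
  qed
qed

section \<open>Random walks and their doubling\<close>

text \<open>The randomness of a walk is split into a part \<open>I\<close>, which determines the linear coefficient
  \<open>\<alpha>\<close>, and a part \<open>J\<close>, over which collisions of the translation part \<open>\<beta>\<close> are measured
  conditionally on \<open>I\<close>. The number \<open>c\<close> bounds the survival probability inside \<open>A\<close> from below.\<close>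

definition random_walk ::
  "real set \<Rightarrow> real \<Rightarrow> real \<Rightarrow> 'i set \<Rightarrow> 'j set \<Rightarrow> ('i \<Rightarrow> real) \<Rightarrow> ('i \<Rightarrow> 'j \<Rightarrow> real) \<Rightarrow> bool" where
  "random_walk A c u I J \<alpha> \<beta> \<longleftrightarrow> finite I \<and> finite J \<and> I \<noteq> {} \<and> J \<noteq> {} \<and> (\<forall>i\<in>I. \<alpha> i \<noteq> 0) \<and>
    (\<forall>a\<in>A. c * (card I * card J) \<le> card {(i, j) \<in> I \<times> J. \<alpha> i * a + \<beta> i j \<in> A}) \<and>
    (\<Sum>i\<in>I. real (coll J (\<beta> i))) \<le> u * (card I * (card J)\<^sup>2)"

lemma coll_reindex:
  assumes "inj_on \<phi> J"
  shows "coll (\<phi> ` J) g = coll J (g \<circ> \<phi>)"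
proof -
  have "{(i, j) \<in> \<phi> ` J \<times> \<phi> ` J. g i = g j} = map_prod \<phi> \<phi> ` {(i, j) \<in> J \<times> J. g (\<phi> i) = g (\<phi> j)}"
    by (auto simp: image_iff)
  moreover have "inj_on (map_prod \<phi> \<phi>) {(i, j) \<in> J \<times> J. g (\<phi> i) = g (\<phi> j)}"
    using assms by (auto simp: inj_on_def)
  ultimately show ?thesis by (simp add: coll_def card_image)
qed

lemma coll_inj_comp:
  assumes "\<And>x y. \<phi> x = \<phi> y \<longleftrightarrow> x = y"
  shows "coll J (\<lambda>j. \<phi> (g j)) = coll J g"
  by (simp add: coll_def assms)

lemma random_walk_reindex:
  assumes \<phi>: "inj_on \<phi> I" and \<psi>: "inj_on \<psi> J" and W: "random_walk A c u (\<phi> ` I) (\<psi> ` J) \<alpha> \<beta>"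
  shows "random_walk A c u I J (\<lambda>i. \<alpha> (\<phi> i)) (\<lambda>i j. \<beta> (\<phi> i) (\<psi> j))"
proof -
  have "card {(i, j) \<in> I \<times> J. \<alpha> (\<phi> i) * a + \<beta> (\<phi> i) (\<psi> j) \<in> A}
      = card {(i, j) \<in> \<phi> ` I \<times> \<psi> ` J. \<alpha> i * a + \<beta> i j \<in> A}" for a
  proof (rule bij_betw_same_card[of "map_prod \<phi> \<psi>"], rule bij_betw_imageI)
    show "inj_on (map_prod \<phi> \<psi>) {(i, j) \<in> I \<times> J. \<alpha> (\<phi> i) * a + \<beta> (\<phi> i) (\<psi> j) \<in> A}"
      by (rule inj_on_subset[OF map_prod_inj_on[OF \<phi> \<psi>]]) auto
    show "map_prod \<phi> \<psi> ` {(i, j) \<in> I \<times> J. \<alpha> (\<phi> i) * a + \<beta> (\<phi> i) (\<psi> j) \<in> A}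
        = {(i, j) \<in> \<phi> ` I \<times> \<psi> ` J. \<alpha> i * a + \<beta> i j \<in> A}"
      by force
  qed
  moreover have "(\<Sum>i\<in>I. real (coll J (\<lambda>j. \<beta> (\<phi> i) (\<psi> j)))) = (\<Sum>i\<in>\<phi> ` I. real (coll (\<psi> ` J) (\<beta> i)))"
    by (simp add: sum.reindex[OF \<phi>] coll_reindex[OF \<psi>] comp_def)
  ultimately show ?thesis
    using W finite_imageD[OF _ \<phi>] finite_imageD[OF _ \<psi>]
    by (simp add: random_walk_def card_image[OF \<phi>] card_image[OF \<psi>])
qed

text \<open>Doubling turns the index types into products, whereas an induction on the number of
  doublings needs fixed types; moving the index sets to the natural numbers reconciles the
  two.\<close>

lemma random_walk_transfer_nat:
  fixes I :: "'i set" and J :: "'j set"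
  assumes "random_walk A c u I J \<alpha> \<beta>"
  shows "\<exists>(I' :: nat set) (J' :: nat set) \<alpha>' \<beta>'. random_walk A c u I' J' \<alpha>' \<beta>'"
proof -
  have fin: "finite I" "finite J" using assms by (auto simp: random_walk_def)
  obtain \<phi> where \<phi>: "bij_betw \<phi> {0..<card I} I" using ex_bij_betw_nat_finite[OF fin(1)] by blast
  obtain \<psi> where \<psi>: "bij_betw \<psi> {0..<card J} J" using ex_bij_betw_nat_finite[OF fin(2)] by blast
  have "random_walk A c u (\<phi> ` {0..<card I}) (\<psi> ` {0..<card J}) \<alpha> \<beta>"
    using assms by (simp only: bij_betw_imp_surj_on[OF \<phi>] bij_betw_imp_surj_on[OF \<psi>])
  from random_walk_reindex[OF bij_betw_imp_inj_on[OF \<phi>] bij_betw_imp_inj_on[OF \<psi>] this]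
  show ?thesis by blast
qed

text \<open>The survival bound \<open>p\<close> holds from every point of \<open>A\<close>, hence
  also from the random point reached by a first move that stayed in \<open>A\<close>; so the
  proportions multiply.\<close>

lemma card_survival_compose:
  fixes p q :: real
  assumes "finite X" "finite Y" "p \<ge> 0"
    and X: "\<And>a. a \<in> A \<Longrightarrow> p * card X \<le> card {x \<in> X. f x a \<in> A}"
    and Y: "\<And>a. a \<in> A \<Longrightarrow> q * card Y \<le> card {y \<in> Y. g y a \<in> A}"
    and a: "a \<in> A"
  shows "p * q * card (X \<times> Y) \<le> card {p \<in> X \<times> Y. f (fst p) (g (snd p) a) \<in> A}"
proof -
  let ?Y = "{y \<in> Y. g y a \<in> A}"
  have "p * q * card (X \<times> Y) = p * card X * (q * card Y)" by (simp add: card_cartesian_product)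
  also have "\<dots> \<le> p * card X * card ?Y"
    using Y[OF a] assms(3) by (intro mult_left_mono) auto
  also have "\<dots> = (\<Sum>y\<in>?Y. p * card X)" by simp
  also have "\<dots> \<le> (\<Sum>y\<in>?Y. real (card {x \<in> X. f x (g y a) \<in> A}))"
    using X by (intro sum_mono) auto
  also have "\<dots> = card (Sigma ?Y (\<lambda>y. {x \<in> X. f x (g y a) \<in> A}))"
    using assms by simp
  also have "card (Sigma ?Y (\<lambda>y. {x \<in> X. f x (g y a) \<in> A}))
      \<le> card {p \<in> X \<times> Y. f (fst p) (g (snd p) a) \<in> A}"
  proof (rule card_inj_on_le)
    show "inj_on prod.swap (Sigma ?Y (\<lambda>y. {x \<in> X. f x (g y a) \<in> A}))" by (auto simp: inj_on_def)
    show "finite {p \<in> X \<times> Y. f (fst p) (g (snd p) a) \<in> A}"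
      by (rule finite_subset[of _ "X \<times> Y"]) (use assms in auto)
  qed auto
  finally show ?thesis by simp
qed

text \<open>The middle step of slope \<open>s\<close> is independent of both copies of the walk, so that, conditionally
  on everything but \<open>s\<close> and the two copies of \<open>J\<close>, the new translation part is \<open>X + s Y\<close> up to a constant.\<close>

lemma random_walk_double:
  fixes I :: "'i set" and J :: "'j set" and S :: "real set" and Q :: "'q set" and c0 :: real
  assumes W: "random_walk A c u I J \<alpha> \<beta>" and "c \<ge> 0" "c0 \<ge> 0" "u > 0"
    and S: "finite S" "0 \<notin> S" "S \<noteq> {}" and Q: "finite Q" "Q \<noteq> {}" "\<And>q. q \<in> Q \<Longrightarrow> t q \<noteq> 0"
    and step: "\<And>a. a \<in> A \<Longrightarrow> c0 * card (S \<times> Q) \<le> card {(s, q) \<in> S \<times> Q. s * t q * a + r s q \<in> A}"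
    and u: "sqrt (card S) * u \<le> 1"
  shows "random_walk A (c * c0 * c) (15 * u / sqrt (card S)) (I \<times> (S \<times> Q) \<times> I) (J \<times> J)
    (\<lambda>(i, (s, q), i'). \<alpha> i * (s * t q) * \<alpha> i')
    (\<lambda>(i, (s, q), i') (j, j'). (\<beta> i j + s * (\<alpha> i * t q * \<beta> i' j')) + \<alpha> i * r s q)"
    (is "random_walk A _ _ ?I ?J ?\<alpha> ?\<beta>")
proof -
  have fin: "finite I" "finite J" "I \<noteq> {}" "J \<noteq> {}" and \<alpha>: "\<And>i. i \<in> I \<Longrightarrow> \<alpha> i \<noteq> 0"
    and surv': "\<And>a. a \<in> A \<Longrightarrow> c * (card I * card J) \<le> card {(i, j) \<in> I \<times> J. \<alpha> i * a + \<beta> i j \<in> A}"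
    and col: "(\<Sum>i\<in>I. real (coll J (\<beta> i))) \<le> u * (card I * (card J)\<^sup>2)"
    using W unfolding random_walk_def by blast+
  let ?f = "\<lambda>(i, j) a. \<alpha> i * a + \<beta> i j" and ?g = "\<lambda>(s, q) a. s * t q * a + r s q"
  have surv: "c * card (I \<times> J) \<le> card {x \<in> I \<times> J. ?f x a \<in> A}" if "a \<in> A" for a
  proof -
    have "{x \<in> I \<times> J. ?f x a \<in> A} = {(i, j) \<in> I \<times> J. \<alpha> i * a + \<beta> i j \<in> A}" by auto
    then show ?thesis using surv'[OF that] by (simp only: card_cartesian_product)
  qed
  have step': "c0 * card (S \<times> Q) \<le> card {x \<in> S \<times> Q. ?g x a \<in> A}" if "a \<in> A" for a
  proof -
    have "{x \<in> S \<times> Q. ?g x a \<in> A} = {(s, q) \<in> S \<times> Q. s * t q * a + r s q \<in> A}" by auto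
    then show ?thesis using step[OF that] by (simp only:)
  qed
  have "c * c0 * c * (card ?I * card ?J) \<le> card {(x, y) \<in> ?I \<times> ?J. ?\<alpha> x * a + ?\<beta> x y \<in> A}"
    if a: "a \<in> A" for a
  proof -
    have 1: "c0 * c * card ((S \<times> Q) \<times> (I \<times> J))
        \<le> card {p \<in> (S \<times> Q) \<times> (I \<times> J). ?g (fst p) (?f (snd p) a) \<in> A}" if "a \<in> A" for a
      by (rule card_survival_compose[OF finite_cartesian_product[OF S(1) Q(1)]
          finite_cartesian_product[OF fin(1,2)] \<open>c0 \<ge> 0\<close> step' surv that])
    have "c * (c0 * c) * card ((I \<times> J) \<times> (S \<times> Q) \<times> (I \<times> J))
        \<le> card {p \<in> (I \<times> J) \<times> (S \<times> Q) \<times> (I \<times> J). ?f (fst p) (?g (fst (snd p)) (?f (snd (snd p)) a)) \<in> A}"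
      by (rule card_survival_compose[OF finite_cartesian_product[OF fin(1,2)] finite_cartesian_product[OF
            finite_cartesian_product[OF S(1) Q(1)] finite_cartesian_product[OF fin(1,2)]] \<open>c \<ge> 0\<close> surv 1 a])
    also have "card {p \<in> (I \<times> J) \<times> (S \<times> Q) \<times> (I \<times> J). ?f (fst p) (?g (fst (snd p)) (?f (snd (snd p)) a)) \<in> A}
        \<le> card {(x, y) \<in> ?I \<times> ?J. ?\<alpha> x * a + ?\<beta> x y \<in> A}"
    proof (rule card_inj_on_le)
      let ?h = "\<lambda>((i, j), sq, (i', j')). ((i, sq, i'), (j, j'))"
      show "inj_on ?h {p \<in> (I \<times> J) \<times> (S \<times> Q) \<times> (I \<times> J). ?f (fst p) (?g (fst (snd p)) (?f (snd (snd p)) a)) \<in> A}"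
        by (auto simp: inj_on_def)
      show "?h ` {p \<in> (I \<times> J) \<times> (S \<times> Q) \<times> (I \<times> J). ?f (fst p) (?g (fst (snd p)) (?f (snd (snd p)) a)) \<in> A}
          \<subseteq> {(x, y) \<in> ?I \<times> ?J. ?\<alpha> x * a + ?\<beta> x y \<in> A}"
        by (auto simp: algebra_simps)
      show "finite {(x, y) \<in> ?I \<times> ?J. ?\<alpha> x * a + ?\<beta> x y \<in> A}"
        by (rule finite_subset[of _ "?I \<times> ?J"]) (use fin S Q in auto)
    qed
    finally show ?thesis by (simp add: card_cartesian_product mult_ac)
  qed
  moreover have "(\<Sum>x\<in>?I. real (coll ?J (?\<beta> x))) \<le> 15 * u / sqrt (card S) * (card ?I * (card ?J)\<^sup>2)"
  proof -
    let ?C = "\<lambda>i. real (coll J (\<beta> i))" and ?K = "real (card S)" and ?m = "real (card J)" and ?n = "real (card I)"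
    \<comment> \<open>This choice balances the two terms of \<open>sum_coll_le\<close>: after
      normalisation they are \<open>h\<^sup>2\<close> and \<open>4 * h\<^sup>2\<close>, and
      \<open>3 / h * (5 * h\<^sup>2) = 15 * h\<close>. The assumption on \<open>u\<close> says
      exactly \<open>h \<le> 1\<close>.\<close>
    define h where "h = sqrt ?K * u"
    have K: "?K > 0" using S by (simp add: card_gt_0_iff)
    have h: "0 < h" "h \<le> 1" using K \<open>u > 0\<close> u by (auto simp: h_def)
    have inner: "(\<Sum>s\<in>S. real (coll ?J (\<lambda>(j, j'). (\<beta> i j + s * (\<alpha> i * t q * \<beta> i' j')) + \<alpha> i * r s q)))
        \<le> 3 / h * (?K * (?C i * ?C i') + 4 * h\<^sup>2 * ?m\<^sup>2 * ?m\<^sup>2)"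
      if "i \<in> I" "i' \<in> I" "q \<in> Q" for i i' q
    proof -
      \<comment> \<open>The shift \<open>\<alpha> i * r s q\<close> does not depend on
        \<open>j\<close> and \<open>j'\<close>, so it cancels in collisions; the nonzero factor
        \<open>\<alpha> i * t q\<close> below is equally harmless.\<close>
      have "coll ?J (\<lambda>(j, j'). (\<beta> i j + s * (\<alpha> i * t q * \<beta> i' j')) + \<alpha> i * r s q)
          = coll ?J (\<lambda>(j, j'). \<beta> i j + s * (\<alpha> i * t q * \<beta> i' j'))" for s
        by (simp add: coll_def case_prod_unfold)
      moreover have "coll J (\<lambda>j. \<alpha> i * t q * \<beta> i' j) = coll J (\<beta> i')"
        using \<alpha>[OF that(1)] Q(3)[OF that(3)] by (intro coll_inj_comp) simp
      ultimately show ?thesis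
        using sum_coll_le[OF fin(2) fin(2) S(1,2) h, of "\<beta> i" "\<lambda>j. \<alpha> i * t q * \<beta> i' j"] by simp
    qed
    have "(\<Sum>x\<in>?I. real (coll ?J (?\<beta> x)))
        = (\<Sum>i\<in>I. \<Sum>s\<in>S. \<Sum>q\<in>Q. \<Sum>i'\<in>I.
            real (coll ?J (\<lambda>(j, j'). (\<beta> i j + s * (\<alpha> i * t q * \<beta> i' j')) + \<alpha> i * r s q)))"
      by (simp add: sum.cartesian_product' case_prod_unfold)
    \<comment> \<open>The slope is summed innermost, since the gain appears only on averaging over
      it.\<close>
    also have "\<dots> = (\<Sum>i\<in>I. \<Sum>q\<in>Q. \<Sum>i'\<in>I. \<Sum>s\<in>S.
            real (coll ?J (\<lambda>(j, j'). (\<beta> i j + s * (\<alpha> i * t q * \<beta> i' j')) + \<alpha> i * r s q)))"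
      by (intro sum.cong refl, subst sum.swap, intro sum.cong refl, subst sum.swap) simp
    also have "\<dots> \<le> (\<Sum>i\<in>I. \<Sum>q\<in>Q. \<Sum>i'\<in>I. 3 / h * (?K * (?C i * ?C i') + 4 * h\<^sup>2 * ?m\<^sup>2 * ?m\<^sup>2))"
      by (intro sum_mono inner)
    \<comment> \<open>The two copies carry independent indices \<open>i\<close> and
      \<open>i'\<close>, so the sum of products factors. This is why a collision bound on average
      over \<open>I\<close> suffices.\<close>
    also have "\<dots> = 3 / h * real (card Q) * (?K * ((\<Sum>i\<in>I. ?C i) * (\<Sum>i\<in>I. ?C i)) + ?n\<^sup>2 * (4 * h\<^sup>2 * ?m\<^sup>2 * ?m\<^sup>2))"
    proof -
      have "(\<Sum>i\<in>I. \<Sum>q\<in>Q. \<Sum>i'\<in>I. G * (?K * (?C i * ?C i') + D))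
          = G * real (card Q) * (?K * ((\<Sum>i\<in>I. ?C i) * (\<Sum>i\<in>I. ?C i)) + ?n\<^sup>2 * D)" for G D :: real
        unfolding sum_product
        by (simp add: sum.distrib sum_distrib_left power2_eq_square algebra_simps)
      then show ?thesis .
    qed
    also have "\<dots> \<le> 3 / h * real (card Q) * (?K * ((u * (?n * ?m\<^sup>2)) * (u * (?n * ?m\<^sup>2))) + ?n\<^sup>2 * (4 * h\<^sup>2 * ?m\<^sup>2 * ?m\<^sup>2))"
      using col h \<open>u > 0\<close>
      by (intro mult_left_mono add_mono mult_mono order_refl) (auto intro!: sum_nonneg)
    also have "\<dots> = 15 * h * real (card Q) * ?n\<^sup>2 * (?m\<^sup>2 * ?m\<^sup>2)"
    proof -
      have "?K * ((u * (?n * ?m\<^sup>2)) * (u * (?n * ?m\<^sup>2))) = h\<^sup>2 * ?n\<^sup>2 * (?m\<^sup>2 * ?m\<^sup>2)"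
        by (simp add: h_def power2_eq_square mult_ac)
      then show ?thesis using h(1) by (simp only:) (simp add: field_simps power2_eq_square)
    qed
    also have "\<dots> = 15 * u / sqrt ?K * (card ?I * (card ?J)\<^sup>2)"
    proof -
      have "u / sqrt ?K * ?K = u * (?K / sqrt ?K)" by simp
      also have "\<dots> = h" using K by (simp only: real_div_sqrt h_def mult.commute)
      finally have h_eq: "h = u / sqrt ?K * ?K" by simp
      show ?thesis by (simp only: h_eq card_cartesian_product of_nat_mult power2_eq_square mult_ac times_divide_eq_left times_divide_eq_right)
    qed
    finally show ?thesis .
  qed
  ultimately show ?thesis
    using fin S Q \<alpha> by (auto simp: random_walk_def)
qed

text \<open>A doubling takes the survival exponent \<open>e\<close> to \<open>2 * e + 1\<close>,
  starting from 1, and multiplies the collision bound by \<open>15 / sqrt (card S)\<close>. This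
  factor is at most 1, so the condition \<open>sqrt (card S) * u \<le> 1\<close> persists.\<close>

lemma random_walk_iterate:
  fixes I :: "'i set" and J :: "'j set" and S :: "real set" and Q :: "'q set"
  assumes W: "random_walk A c u I J \<alpha> \<beta>" and "c \<ge> 0" "u > 0"
    and S: "finite S" "0 \<notin> S" and Q: "finite Q" "Q \<noteq> {}" "\<And>q. q \<in> Q \<Longrightarrow> t q \<noteq> 0"
    and step: "\<And>a. a \<in> A \<Longrightarrow> c * card (S \<times> Q) \<le> card {(s, q) \<in> S \<times> Q. s * t q * a + r s q \<in> A}"
    and u: "sqrt (card S) * u \<le> 1" and K: "15 \<le> sqrt (card S)"
  shows "\<exists>(I' :: nat set) (J' :: nat set) \<alpha>' \<beta>'.
    random_walk A (c ^ (2 ^ Suc k - 1)) (u * (15 / sqrt (card S)) ^ k) I' J' \<alpha>' \<beta>'"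
proof (induction k)
  case 0
  then show ?case using random_walk_transfer_nat[OF W] by simp
next
  case (Suc k)
  then obtain I' J' :: "nat set" and \<alpha>' \<beta>'
    where W': "random_walk A (c ^ (2 ^ Suc k - 1)) (u * (15 / sqrt (card S)) ^ k) I' J' \<alpha>' \<beta>'"
    by blast
  have "S \<noteq> {}" using K by auto
  have "sqrt (card S) > 0" using K by linarith
  then have "15 / sqrt (card S) \<le> 1" "15 / sqrt (card S) > 0" using K by (simp_all only: divide_le_eq_1_pos zero_less_divide_iff) simp_all
  then have "(15 / sqrt (card S)) ^ k \<le> 1" "(15 / sqrt (card S)) ^ k > 0" by (simp_all only: power_le_one zero_less_power less_imp_le)
  then have "sqrt (card S) * (u * (15 / sqrt (card S)) ^ k) \<le> sqrt (card S) * (u * 1)"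
    using \<open>u > 0\<close> by (intro mult_left_mono) auto
  also have "\<dots> \<le> 1" using u by simp
  finally have u': "sqrt (card S) * (u * (15 / sqrt (card S)) ^ k) \<le> 1" .
  have u_pos: "u * (15 / sqrt (card S)) ^ k > 0"
    using \<open>(15 / sqrt (card S)) ^ k > 0\<close> \<open>u > 0\<close> by simp
  have c_nonneg: "c ^ (2 ^ Suc k - 1) \<ge> 0" using \<open>c \<ge> 0\<close> by simp
  have c_eq: "c ^ (2 ^ Suc k - 1) * c * c ^ (2 ^ Suc k - 1) = c ^ (2 ^ Suc (Suc k) - 1)"
  proof -
    have "(1::nat) \<le> 2 ^ Suc k" by simp
    then have "2 ^ Suc (Suc k) - 1 = (2 ^ Suc k - 1) + Suc ((2::nat) ^ Suc k - 1)" by simp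
    then show ?thesis by (simp only: power_Suc power_add mult_ac)
  qed
  have u_eq: "15 * (u * (15 / sqrt (card S)) ^ k) / sqrt (card S) = u * (15 / sqrt (card S)) ^ Suc k"
    by simp
  from random_walk_transfer_nat[OF random_walk_double[OF W' c_nonneg \<open>c \<ge> 0\<close> u_pos S \<open>S \<noteq> {}\<close> Q step u']]
  show ?case unfolding c_eq u_eq .
qed

text \<open>For a fixed start \<open>a\<close> and a fixed \<open>i\<close>, the surviving end
  points take at most \<open>card A\<close> values, so Cauchy-Schwarz over \<open>J\<close> bounds
  their number through the collisions of \<open>\<beta> i\<close>. A second Cauchy-Schwarz averages
  over \<open>I\<close>.\<close>

lemma random_walk_survival_le:
  assumes W: "random_walk A c u I J \<alpha> \<beta>" and "finite A" "A \<noteq> {}" "c \<ge> 0"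
  shows "c\<^sup>2 \<le> u * card A"
proof -
  have fin: "finite I" "finite J" "I \<noteq> {}" "J \<noteq> {}"
    and surv: "\<And>a. a \<in> A \<Longrightarrow> c * (card I * card J) \<le> card {(i, j) \<in> I \<times> J. \<alpha> i * a + \<beta> i j \<in> A}"
    and col: "(\<Sum>i\<in>I. real (coll J (\<beta> i))) \<le> u * (card I * (card J)\<^sup>2)"
    using W by (auto simp: random_walk_def)
  obtain a where a: "a \<in> A" using assms by blast
  let ?P = "\<lambda>i. {j \<in> J. \<alpha> i * a + \<beta> i j \<in> A}"
  have P: "(real (card (?P i)))\<^sup>2 \<le> card A * real (coll J (\<beta> i))" for i
  proof -
    have "(card (?P i))\<^sup>2 \<le> card ((\<lambda>j. \<alpha> i * a + \<beta> i j) ` ?P i) * coll (?P i) (\<lambda>j. \<alpha> i * a + \<beta> i j)"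
      using fin by (intro card_power2_le_coll) auto
    also have "\<dots> \<le> card A * coll J (\<beta> i)"
    proof (rule mult_le_mono)
      show "card ((\<lambda>j. \<alpha> i * a + \<beta> i j) ` ?P i) \<le> card A"
        using assms by (intro card_mono) auto
      show "coll (?P i) (\<lambda>j. \<alpha> i * a + \<beta> i j) \<le> coll J (\<beta> i)"
        unfolding coll_def
        by (intro card_mono finite_subset[of "{(j, j') \<in> J \<times> J. \<beta> i j = \<beta> i j'}" "J \<times> J"]) (use fin in auto)
    qed
    finally show ?thesis by (metis of_nat_le_iff of_nat_mult of_nat_power)
  qed
  have "{(i, j) \<in> I \<times> J. \<alpha> i * a + \<beta> i j \<in> A} = Sigma I ?P" by auto
  then have eq: "real (card {(i, j) \<in> I \<times> J. \<alpha> i * a + \<beta> i j \<in> A}) = (\<Sum>i\<in>I. real (card (?P i)))"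
    using fin by simp
  have "(c * (card I * card J))\<^sup>2 \<le> (\<Sum>i\<in>I. real (card (?P i)))\<^sup>2"
    using surv[OF a] \<open>c \<ge> 0\<close> unfolding eq by (intro power_mono) auto
  also have "\<dots> \<le> (\<Sum>i\<in>I. (real (card (?P i)))\<^sup>2) * card I"
    by (rule sum_squared_le_sum_of_squares)
  also have "\<dots> \<le> (\<Sum>i\<in>I. card A * real (coll J (\<beta> i))) * card I"
    by (intro mult_right_mono sum_mono P) simp
  also have "\<dots> = card A * (\<Sum>i\<in>I. real (coll J (\<beta> i))) * card I"
    by (simp add: sum_distrib_left)
  also have "\<dots> \<le> card A * (u * (card I * (card J)\<^sup>2)) * card I"
    using col by (intro mult_right_mono mult_left_mono) auto
  finally have "c\<^sup>2 * (real (card I) * card J)\<^sup>2 \<le> u * card A * (real (card I) * card J)\<^sup>2"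
    by (simp add: power2_eq_square mult_ac)
  moreover have "(real (card I) * card J)\<^sup>2 > 0" using fin by (simp add: card_gt_0_iff)
  ultimately show ?thesis by (rule mult_right_le_imp_le)
qed

section \<open>From many incidences to a random walk\<close>

text \<open>In the pruned core a random line leads from a point of \<open>A'\<close> into
  \<open>B'\<close> with proportion at least \<open>c\<close>, and the inverse of a second one leads
  back into \<open>A'\<close> with proportion at least \<open>c\<close>. Such round trips, surviving
  with proportion \<open>c\<^sup>2\<close>, are the steps of the walk.\<close>

lemma walk_bound:
  fixes A B S :: "real set" and e :: "real \<Rightarrow> nat \<Rightarrow> real" and c :: real
  assumes fin: "finite A" "finite B" "finite S" and S: "0 \<notin> S" and c: "c \<ge> 0"
    and inj: "\<And>s. s \<in> S \<Longrightarrow> inj_on (e s) {..<m}"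
    and dense: "c * (card S * m) * (card A + card B)
      < card {((s, k), a) \<in> (S \<times> {..<m}) \<times> A. s * a + e s k \<in> B}"
    and K: "15 \<le> sqrt (card S)" "sqrt (card S) \<le> m"
  shows "(c\<^sup>2 ^ (2 ^ Suc j - 1))\<^sup>2 \<le> 1 / m * (15 / sqrt (card S)) ^ j * card A"
proof -
  let ?X = "S \<times> {..<m}" and ?f = "\<lambda>(s, k) a. s * a + e s k"
  have m: "m > 0"
  proof -
    have "real m > 0" using K by linarith
    then show ?thesis by simp
  qed
  have finX: "finite ?X" using fin by simp
  have cardX: "card ?X = card S * m" by (simp add: card_cartesian_product)
  have "{(x, a) \<in> ?X \<times> A. ?f x a \<in> B} = {((s, k), a) \<in> ?X \<times> A. s * a + e s k \<in> B}" by auto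
  then have dense': "c * card ?X * (card A + card B) < card {(x, a) \<in> ?X \<times> A. ?f x a \<in> B}"
    using dense by (simp only: cardX of_nat_mult)
  have inj_f: "inj (?f x)" if "x \<in> ?X" for x
    using that S by (auto simp: inj_def)
  obtain A' B' where A': "A' \<subseteq> A" "B' \<subseteq> B" "A' \<noteq> {}"
    and deg_A: "\<And>a. a \<in> A' \<Longrightarrow> c * card ?X \<le> card {x \<in> ?X. ?f x a \<in> B'}"
    and deg_B: "\<And>b. b \<in> B' \<Longrightarrow> c * card ?X \<le> card {x \<in> ?X. b \<in> ?f x ` A'}"
  proof -
    have "c * card ?X \<ge> 0" using c by simp
    from min_degree_core[OF finX fin(1,2) inj_f this dense'] show thesis using that by blast
  qed
  have finA': "finite A'" using A' fin finite_subset by blast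
  let ?Q = "{..<m} \<times> S \<times> {..<m}"
  \<comment> \<open>The round trip is
    \<open>s * t q * a + r s q = (s * a + e s k - e s' k') / s'\<close>. The slope \<open>s\<close>
    stays outside \<open>q\<close>, being the variable over which a doubling averages.\<close>
  define t :: "nat \<times> real \<times> nat \<Rightarrow> real" where "t = (\<lambda>(k, s', k'). 1 / s')"
  define r :: "real \<Rightarrow> nat \<times> real \<times> nat \<Rightarrow> real" where "r = (\<lambda>s (k, s', k'). (e s k - e s' k') / s')"
  have t_nz: "t q \<noteq> 0" if "q \<in> ?Q" for q using that S by (auto simp: t_def)
  have finQ: "finite ?Q" using fin by simp
  have cardQ: "card (S \<times> ?Q) = card ?X * card ?X" by (simp add: card_cartesian_product)
  have step: "c\<^sup>2 * card (S \<times> ?Q) \<le> card {(s, q) \<in> S \<times> ?Q. s * t q * a + r s q \<in> A'}"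
    if a: "a \<in> A'" for a
  proof -
    let ?Y = "{x \<in> ?X. ?f x a \<in> B'}"
    let ?Z = "\<lambda>x. {x' \<in> ?X. ?f x a \<in> ?f x' ` A'}"
    have "c\<^sup>2 * card (S \<times> ?Q) = (c * card ?X) * (c * card ?X)"
      unfolding cardQ by (simp add: power2_eq_square)
    also have "\<dots> \<le> card ?Y * (c * card ?X)"
      using deg_A[OF a] c by (intro mult_right_mono) auto
    also have "\<dots> = (\<Sum>x\<in>?Y. c * card ?X)" by simp
    also have "\<dots> \<le> (\<Sum>x\<in>?Y. real (card (?Z x)))"
      by (rule sum_mono, rule deg_B) simp
    also have "\<dots> = card (Sigma ?Y ?Z)" using finX by simp
    also have "card (Sigma ?Y ?Z) \<le> card {(s, q) \<in> S \<times> ?Q. s * t q * a + r s q \<in> A'}"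
    proof (rule card_inj_on_le)
      let ?h = "\<lambda>((s, k), (s', k')). (s, (k, s', k'))"
      show "inj_on ?h (Sigma ?Y ?Z)" by (auto simp: inj_on_def)
      show "finite {(s, q) \<in> S \<times> ?Q. s * t q * a + r s q \<in> A'}"
        by (rule finite_subset[of _ "S \<times> ?Q"]) (use fin in auto)
      show "?h ` Sigma ?Y ?Z \<subseteq> {(s, q) \<in> S \<times> ?Q. s * t q * a + r s q \<in> A'}"
      proof (rule image_subsetI)
        fix p assume p: "p \<in> Sigma ?Y ?Z"
        obtain s k s' k' where p_eq: "p = ((s, k), (s', k'))" by (metis prod.exhaust)
        have mem: "s \<in> S" "k < m" "s' \<in> S" "k' < m" using p unfolding p_eq by auto
        obtain a' where a': "a' \<in> A'" "s * a + e s k = s' * a' + e s' k'"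
          using p unfolding p_eq by auto
        have "s' \<noteq> 0" using mem S by metis
        moreover have "s * t (k, s', k') * a + r s (k, s', k') = (s * a + e s k - e s' k') / s'"
          by (simp add: t_def r_def add_divide_distrib diff_divide_distrib)
        ultimately have "s * t (k, s', k') * a + r s (k, s', k') = a'" using a'(2) by simp
        then show "?h p \<in> {(s, q) \<in> S \<times> ?Q. s * t q * a + r s q \<in> A'}"
          using mem a'(1) by (simp add: p_eq)
      qed
    qed
    finally show ?thesis by simp
  qed
  \<comment> \<open>The initial walk is one round trip, with the first intercept index
    \<open>k\<close> in the role of \<open>J\<close>. The value of \<open>t\<close> is independent
    of its first component, so 0 stands in for it.\<close>
  have base: "random_walk A' (c\<^sup>2) (1 / m) (S \<times> S \<times> {..<m}) {..<m}
      (\<lambda>(s, s', k'). s * t (0, s', k')) (\<lambda>(s, s', k') k. r s (k, s', k'))" (is "random_walk _ _ _ ?I ?J ?\<alpha> ?\<beta>")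
  proof -
    have "S \<noteq> {}" using K(1) by auto
    then have ne: "?I \<noteq> {}" "?J \<noteq> {}" using m by auto
    have \<alpha>: "\<forall>i\<in>?I. ?\<alpha> i \<noteq> 0" using S by (auto simp: t_def)
    have surv: "c\<^sup>2 * (card ?I * card ?J) \<le> card {(i, k) \<in> ?I \<times> ?J. ?\<alpha> i * a + ?\<beta> i k \<in> A'}" if "a \<in> A'" for a
    proof -
      have "c\<^sup>2 * (card ?I * card ?J) = c\<^sup>2 * card (S \<times> ?Q)" by (simp add: card_cartesian_product mult_ac)
      also have "\<dots> \<le> card {(s, q) \<in> S \<times> ?Q. s * t q * a + r s q \<in> A'}" by (rule step[OF that])
      also have "card {(s, q) \<in> S \<times> ?Q. s * t q * a + r s q \<in> A'}
          \<le> card {(i, k) \<in> ?I \<times> ?J. ?\<alpha> i * a + ?\<beta> i k \<in> A'}"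
      proof (rule card_inj_on_le)
        let ?h = "\<lambda>(s, (k, s', k')). ((s, s', k'), k)"
        show "inj_on ?h {(s, q) \<in> S \<times> ?Q. s * t q * a + r s q \<in> A'}" by (auto simp: inj_on_def)
        show "finite {(i, k) \<in> ?I \<times> ?J. ?\<alpha> i * a + ?\<beta> i k \<in> A'}"
          by (rule finite_subset[of _ "?I \<times> ?J"]) (use fin in auto)
        show "?h ` {(s, q) \<in> S \<times> ?Q. s * t q * a + r s q \<in> A'}
            \<subseteq> {(i, k) \<in> ?I \<times> ?J. ?\<alpha> i * a + ?\<beta> i k \<in> A'}"
          by (auto simp: t_def)
      qed
      finally show ?thesis by simp
    qed
    have col: "(\<Sum>i\<in>?I. real (coll ?J (?\<beta> i))) \<le> 1 / m * (card ?I * (card ?J)\<^sup>2)"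
    proof -
      have "coll ?J (?\<beta> i) = m" if "i \<in> ?I" for i
      proof -
        obtain s s' k' where i: "i = (s, s', k')" by (metis prod.exhaust)
        then have s: "s \<in> S" "s' \<noteq> 0" using that S by auto
        \<comment> \<open>With both slopes and the second intercept fixed, the translation is
          injective in \<open>k\<close>, so only diagonal pairs collide.\<close>
        have "{(k, l) \<in> ?J \<times> ?J. ?\<beta> i k = ?\<beta> i l} = (\<lambda>k. (k, k)) ` ?J"
          using s(2) inj_onD[OF inj[OF s(1)]] by (auto simp: i r_def)
        moreover have "card ((\<lambda>k. (k, k)) ` ?J) = m" by (subst card_image) (auto simp: inj_on_def)
        ultimately show ?thesis by (simp add: coll_def)
      qed
      then have "(\<Sum>i\<in>?I. real (coll ?J (?\<beta> i))) = card ?I * m" by simp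
      also have "\<dots> = 1 / m * (card ?I * (card ?J)\<^sup>2)" using m by (simp add: power2_eq_square)
      finally show ?thesis by simp
    qed
    have finI: "finite ?I" "finite ?J" using fin by auto
    show ?thesis
      unfolding random_walk_def
      by (intro conjI ballI finI ne \<alpha>[rule_format] surv col)
  qed
  have "S \<noteq> {}" using K(1) by auto
  then have neQ: "?Q \<noteq> {}" using m by auto
  \<comment> \<open>This is the condition on \<open>u\<close> for the starting value
    \<open>u = 1 / m\<close>.\<close>
  have "sqrt (card S) * (1 / m) \<le> 1" using K m by simp
  then obtain I' J' :: "nat set" and \<alpha>' \<beta>' where
    "random_walk A' (c\<^sup>2 ^ (2 ^ Suc j - 1)) (1 / m * (15 / sqrt (card S)) ^ j) I' J' \<alpha>' \<beta>'"
    using random_walk_iterate[OF base _ _ fin(3) S finQ neQ t_nz step _ K(1), of j] m by auto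
  then have "(c\<^sup>2 ^ (2 ^ Suc j - 1))\<^sup>2 \<le> 1 / m * (15 / sqrt (card S)) ^ j * card A'"
    by (rule random_walk_survival_le) (use finA' A' in auto)
  also have "\<dots> \<le> 1 / m * (15 / sqrt (card S)) ^ j * card A"
    using card_mono[OF fin(1) A'(1)] by (intro mult_left_mono) auto
  finally show ?thesis .
qed

section \<open>Lines, slopes and parallel classes\<close>

definition sloped_line :: "real \<Rightarrow> real \<Rightarrow> (real \<times> real) set" where
  "sloped_line s d = {(x, y). y = s * x + d}"

definition vertical_line :: "real \<Rightarrow> (real \<times> real) set" where
  "vertical_line c = {(x, y). x = c}"

lemma sloped_line_eq_iff: "sloped_line s d = sloped_line s' d' \<longleftrightarrow> s = s' \<and> d = d'"
proof
  assume eq: "sloped_line s d = sloped_line s' d'"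
  have "(0, d) \<in> sloped_line s' d'" "(1, s + d) \<in> sloped_line s' d'"
    unfolding eq[symmetric] by (auto simp: sloped_line_def)
  then show "s = s' \<and> d = d'" by (auto simp: sloped_line_def)
qed simp

lemma line_eq_sloped_line: "b \<noteq> 0 \<Longrightarrow> {(x, y). a * x + b * y = c} = sloped_line (- a / b) (c / b)"
  by (auto simp: sloped_line_def field_simps)

lemma line_eq_vertical_line: "a \<noteq> 0 \<Longrightarrow> {(x, y). a * x + 0 * y = c} = vertical_line (c / a)"
  by (auto simp: vertical_line_def field_simps)

lemma is_lineE:
  assumes "is_line L"
  obtains (sloped) s d where "L = sloped_line s d" | (vertical) c where "L = vertical_line c"
proof -
  obtain a b c where "(a, b) \<noteq> (0, 0)" and L: "L = {(x, y). a * x + b * y = c}"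
    using assms unfolding is_line_def by blast
  then show thesis
    using line_eq_sloped_line[of b a c] line_eq_vertical_line[of a c] that by (cases "b = 0") auto
qed

lemma parallel_sloped_line_iff: "parallel (sloped_line s d) M \<longleftrightarrow> (\<exists>d'. M = sloped_line s d')"
proof
  assume "parallel (sloped_line s d) M"
  then obtain a b c c' where ab: "(a, b) \<noteq> (0, 0)" and L: "sloped_line s d = {(x, y). a * x + b * y = c}"
    and M: "M = {(x, y). a * x + b * y = c'}"
    unfolding parallel_def by blast
  have "(0, d) \<in> sloped_line s d" "(1, s + d) \<in> sloped_line s d" by (auto simp: sloped_line_def)
  then have "b * d = c" "a + b * (s + d) = c" unfolding L by auto
  then have a: "a = - b * s" by (simp add: algebra_simps)
  then have "b \<noteq> 0" using ab by auto
  then have "M = sloped_line s (c' / b)" using line_eq_sloped_line[of b a c'] a M by simp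
  then show "\<exists>d'. M = sloped_line s d'" ..
next
  assume "\<exists>d'. M = sloped_line s d'"
  then obtain d' where M: "M = sloped_line s d'" ..
  have "sloped_line s d = {(x, y). (- s) * x + 1 * y = d}" for d
    by (auto simp: sloped_line_def)
  then show "parallel (sloped_line s d) M"
    unfolding parallel_def M by (intro exI[of _ "- s"] exI[of _ 1] exI[of _ d] exI[of _ d']) auto
qed

lemma parallel_vertical_line_iff: "parallel (vertical_line c) M \<longleftrightarrow> (\<exists>c'. M = vertical_line c')"
proof
  assume "parallel (vertical_line c) M"
  then obtain a b f f' where ab: "(a, b) \<noteq> (0, 0)" and L: "vertical_line c = {(x, y). a * x + b * y = f}"
    and M: "M = {(x, y). a * x + b * y = f'}"
    unfolding parallel_def by blast
  have "(c, 0) \<in> vertical_line c" "(c, 1) \<in> vertical_line c" by (auto simp: vertical_line_def)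
  then have "a * c = f" "a * c + b = f" unfolding L by auto
  then have b: "b = 0" by simp
  then have "M = vertical_line (f' / a)" using line_eq_vertical_line[of a f'] ab M by simp
  then show "\<exists>c'. M = vertical_line c'" ..
next
  assume "\<exists>c'. M = vertical_line c'"
  then obtain c' where M: "M = vertical_line c'" ..
  have "vertical_line c = {(x, y). 1 * x + 0 * y = c}" for c
    by (auto simp: vertical_line_def)
  then show "parallel (vertical_line c) M"
    unfolding parallel_def M by (intro exI[of _ 1] exI[of _ 0] exI[of _ c] exI[of _ c']) auto
qed

lemma finite_slopes_and_intercepts:
  assumes "finite \<L>"
  shows "finite {s. \<exists>d. sloped_line s d \<in> \<L>}" "finite {d. sloped_line s d \<in> \<L>}"
proof -
  have "finite ((\<lambda>(s, d). sloped_line s d) -` \<L>)"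
    using assms by (rule finite_vimageI) (auto simp: inj_def sloped_line_eq_iff)
  then show "finite {s. \<exists>d. sloped_line s d \<in> \<L>}"
  proof (rule finite_surj)
    show "{s. \<exists>d. sloped_line s d \<in> \<L>} \<subseteq> fst ` ((\<lambda>(s, d). sloped_line s d) -` \<L>)"
    proof
      fix s assume "s \<in> {s. \<exists>d. sloped_line s d \<in> \<L>}"
      then obtain d where "(s, d) \<in> (\<lambda>(s, d). sloped_line s d) -` \<L>" by auto
      then show "s \<in> fst ` ((\<lambda>(s, d). sloped_line s d) -` \<L>)" by (rule image_eqI[rotated]) simp
    qed
  qed
  have "finite (sloped_line s -` \<L>)"
    using assms by (rule finite_vimageI) (auto simp: inj_def sloped_line_eq_iff)
  then show "finite {d. sloped_line s d \<in> \<L>}" by (simp add: vimage_def)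
qed

text \<open>The 2 stands for the vertical and the horizontal class, set aside because the walk needs
  lines that act as invertible maps \<open>x \<mapsto> s * x + d\<close>.\<close>

lemma num_slopes_le:
  assumes "finite \<L>" and lines: "\<forall>L\<in>\<L>. is_line L"
  shows "num_slopes \<L> \<le> card {s. s \<noteq> 0 \<and> (\<exists>d. sloped_line s d \<in> \<L>)} + 2"
proof -
  let ?T = "{s. s \<noteq> 0 \<and> (\<exists>d. sloped_line s d \<in> \<L>)}"
  let ?V = "{M \<in> \<L>. \<exists>c. M = vertical_line c}" and ?g = "\<lambda>s. {M \<in> \<L>. \<exists>d. M = sloped_line s d}"
  have finT: "finite ?T" using finite_slopes_and_intercepts(1)[OF assms(1)] by (rule rev_finite_subset) auto
  have "{M \<in> \<L>. parallel L M} \<in> insert ?V (insert (?g 0) (?g ` ?T))" if "L \<in> \<L>" for L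
  proof -
    have "is_line L" using lines that by blast
    then show ?thesis
    proof (cases rule: is_lineE)
      case (sloped s d)
      have "{M \<in> \<L>. parallel L M} = ?g s" unfolding sloped parallel_sloped_line_iff ..
      moreover have "s = 0 \<or> s \<in> ?T" using sloped that by blast
      ultimately show ?thesis by blast
    next
      case (vertical c)
      have "{M \<in> \<L>. parallel L M} = ?V" unfolding vertical parallel_vertical_line_iff ..
      then show ?thesis by blast
    qed
  qed
  then have "num_slopes \<L> \<le> card (insert ?V (insert (?g 0) (?g ` ?T)))"
    unfolding num_slopes_def using finT by (intro card_mono) auto
  also have "\<dots> \<le> card (?g ` ?T) + 2"
    using finT by (simp add: card_insert_if)
  also have "\<dots> \<le> card ?T + 2" using card_image_le[OF finT] by simp
  finally show ?thesis .
qed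

lemma card_parallel_less:
  assumes "finite \<L>" "sloped_line s d \<in> \<L>"
  shows "card {M \<in> \<L>. M \<noteq> sloped_line s d \<and> parallel (sloped_line s d) M} < card {d. sloped_line s d \<in> \<L>}"
proof -
  have fin: "finite {d. sloped_line s d \<in> \<L>}" by (rule finite_slopes_and_intercepts(2)[OF assms(1)])
  have "{M \<in> \<L>. M \<noteq> sloped_line s d \<and> parallel (sloped_line s d) M}
      \<subseteq> sloped_line s ` ({d. sloped_line s d \<in> \<L>} - {d})"
    by (auto simp: parallel_sloped_line_iff)
  then have "card {M \<in> \<L>. M \<noteq> sloped_line s d \<and> parallel (sloped_line s d) M}
      \<le> card ({d. sloped_line s d \<in> \<L>} - {d})"
    using fin by (intro surj_card_le) auto
  also have "\<dots> < card {d. sloped_line s d \<in> \<L>}"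
    using fin assms(2) by (intro card_Diff1_less) auto
  finally show ?thesis .
qed

lemma card_sloped_line_grid_le:
  assumes "finite A"
  shows "card (sloped_line s d \<inter> (A \<times> B)) \<le> card {a \<in> A. s * a + d \<in> B}"
proof (rule card_inj_on_le)
  show "inj_on fst (sloped_line s d \<inter> (A \<times> B))" by (auto simp: inj_on_def sloped_line_def)
  show "fst ` (sloped_line s d \<inter> (A \<times> B)) \<subseteq> {a \<in> A. s * a + d \<in> B}" by (auto simp: sloped_line_def)
qed (use assms in simp)

section \<open>Choice of parameters and conclusion\<close>

text \<open>A regular subfamily is cut out for \<open>walk_bound\<close>: \<open>m - 2\<close>
  nonzero slopes with \<open>m\<close> intercepts each, where \<open>m\<close> is
  \<open>real n powr \<epsilon>\<close> rounded up. The number \<open>j\<close> of doublings is left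
  free.\<close>

lemma rich_lines_bound:
  fixes \<epsilon> \<delta> :: real and n j :: nat
  assumes A: "finite A" "finite B" "card A = n" "card B = n"
    and \<L>: "finite \<L>" "\<forall>L\<in>\<L>. is_line L"
    and slopes: "real (num_slopes \<L>) \<ge> real n powr \<epsilon>"
    and par: "\<forall>L\<in>\<L>. real (card {M \<in> \<L>. M \<noteq> L \<and> parallel L M}) \<ge> real n powr \<epsilon>"
    and rich: "\<forall>L\<in>\<L>. real n powr (1 - \<delta>) \<le> real (card (L \<inter> (A \<times> B)))"
    and n: "300 \<le> real n powr \<epsilon>"
  shows "((((real n powr - \<delta>) / 4)\<^sup>2) ^ (2 ^ Suc j - 1))\<^sup>2 \<le> (30 / real n powr (\<epsilon> / 2)) ^ j * n"
proof -
  let ?T = "{s. s \<noteq> 0 \<and> (\<exists>d. sloped_line s d \<in> \<L>)}" and ?D = "\<lambda>s. {d. sloped_line s d \<in> \<L>}"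
  define m where "m = nat \<lceil>real n powr \<epsilon>\<rceil>"
  have m: "real m \<ge> real n powr \<epsilon>" "m \<ge> 300" unfolding m_def using n by linarith+
  have m_le: "m \<le> k" if "real k \<ge> real n powr \<epsilon>" for k unfolding m_def using that by linarith
  have n0: "n > 0" using n by (cases "n = 0") auto
  have "m - 2 \<le> card ?T" using num_slopes_le[OF \<L>] m_le[OF slopes] by linarith
  then obtain S where S: "S \<subseteq> ?T" "card S = m - 2" "finite S" by (rule obtain_subset_with_card_n)
  \<comment> \<open>As \<open>m \<ge> 300\<close>, the number \<open>m - 2\<close> is at least 225,
    the square of the 15 required by \<open>walk_bound\<close>, and at least a quarter of
    \<open>real n powr \<epsilon>\<close>.\<close>
  have K: "real (card S) \<ge> real n powr \<epsilon> / 4" "card S \<ge> 225" "card S \<le> m"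
    using m S(2) by auto
  have "\<exists>e. inj_on e {..<m} \<and> e ` {..<m} \<subseteq> ?D s" if "s \<in> S" for s
  proof -
    obtain d where d: "sloped_line s d \<in> \<L>" using \<open>s \<in> S\<close> S(1) by blast
    have "m < card (?D s)"
      using card_parallel_less[OF \<L>(1) d] m_le par d by fastforce
    moreover have "finite (?D s)" by (rule finite_slopes_and_intercepts(2)[OF \<L>(1)])
    ultimately show ?thesis
      using card_le_inj[of "{..<m}" "?D s"] by auto
  qed
  then obtain e where e: "\<And>s. s \<in> S \<Longrightarrow> inj_on (e s) {..<m}" "\<And>s. s \<in> S \<Longrightarrow> e s ` {..<m} \<subseteq> ?D s"
    by metis
  \<comment> \<open>The divisor 4 makes every line carry at least \<open>4 * c * n\<close> points,
    twice what \<open>card A + card B = 2 * n\<close> demands, so the density bound is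
    strict.\<close>
  define c where "c = (real n powr - \<delta>) / 4"
  have c: "c > 0" unfolding c_def using n0 by simp
  have cn: "real n powr (1 - \<delta>) = 4 * c * n"
    unfolding c_def using n0 by (simp add: powr_diff powr_minus divide_simps)
  have dense: "c * (card S * m) * (card A + card B) < card {((s, k), a) \<in> (S \<times> {..<m}) \<times> A. s * a + e s k \<in> B}"
  proof -
    let ?E = "\<lambda>x. {a \<in> A. fst x * a + e (fst x) (snd x) \<in> B}"
    have set_eq: "{((s, k), a) \<in> (S \<times> {..<m}) \<times> A. s * a + e s k \<in> B} = Sigma (S \<times> {..<m}) ?E" by auto
    have card_eq: "real (card (Sigma (S \<times> {..<m}) ?E)) = (\<Sum>x\<in>S \<times> {..<m}. real (card (?E x)))"
      using S(3) A(1) by simp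
    have le: "(\<Sum>x\<in>S \<times> {..<m}. 4 * c * n) \<le> (\<Sum>x\<in>S \<times> {..<m}. real (card (?E x)))"
    proof (rule sum_mono)
      fix x assume "x \<in> S \<times> {..<m}"
      then obtain s k where x: "x = (s, k)" "s \<in> S" "k < m" by auto
      then have "sloped_line s (e s k) \<in> \<L>" using e(2) by blast
      then have "real n powr (1 - \<delta>) \<le> card (sloped_line s (e s k) \<inter> (A \<times> B))" using rich by blast
      also have "\<dots> \<le> card (?E x)" using card_sloped_line_grid_le[OF A(1), of s "e s k" B] x by simp
      finally show "4 * c * n \<le> card (?E x)" by (simp add: cn)
    qed
    have const: "(\<Sum>x\<in>S \<times> {..<m}. 4 * c * n) = 4 * (c * (real (card S) * m) * n)"
      by (simp add: card_cartesian_product)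
    have pos: "c * (real (card S) * m) * n > 0" using c K m n0 by (intro mult_pos_pos) auto
    have "c * (card S * m) * (card A + card B) = 2 * (c * (real (card S) * m) * n)"
      by (simp add: A)
    also have "\<dots> < card (Sigma (S \<times> {..<m}) ?E)"
      using card_eq le const pos by linarith
    finally show ?thesis unfolding set_eq .
  qed
  have K1: "15 \<le> sqrt (card S)" using K(2) by (intro real_le_rsqrt) simp
  have K2: "sqrt (card S) \<le> m"
  proof -
    have "sqrt (card S) \<le> card S" using K(2) by (intro real_le_lsqrt) (auto simp: power2_eq_square)
    also have "\<dots> \<le> m" using K by simp
    finally show ?thesis .
  qed
  have "0 \<notin> S" using S(1) by blast
  then have "(c\<^sup>2 ^ (2 ^ Suc j - 1))\<^sup>2 \<le> 1 / m * (15 / sqrt (card S)) ^ j * card A"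
    using walk_bound[OF A(1,2) S(3) _ less_imp_le[OF c] e(1) dense K1 K2] by blast
  \<comment> \<open>The factor \<open>1 / m\<close> is given away, and
    \<open>card S \<ge> real n powr \<epsilon> / 4\<close> turns 15 into 30.\<close>
  also have "\<dots> \<le> 1 * (30 / real n powr (\<epsilon> / 2)) ^ j * card A"
  proof (intro mult_mono order_refl power_mono)
    have "(real n powr (\<epsilon> / 2))\<^sup>2 = real n powr \<epsilon>"
      by (simp add: power2_eq_square flip: powr_add)
    then have "real n powr (\<epsilon> / 2) / 2 = sqrt (real n powr \<epsilon> / 4)"
      by (intro real_sqrt_unique[symmetric]) (auto simp: power_divide)
    also have "\<dots> \<le> sqrt (card S)" using K(1) by (rule real_sqrt_le_mono)
    finally have le: "real n powr (\<epsilon> / 2) / 2 \<le> sqrt (card S)" .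
    have "15 / sqrt (card S) \<le> 15 / (real n powr (\<epsilon> / 2) / 2)"
      using n0 le K(2) by (intro divide_left_mono mult_pos_pos) auto
    then show "15 / sqrt (card S) \<le> 30 / real n powr (\<epsilon> / 2)" by simp
    show "1 / real m \<le> 1" using m by simp
  qed auto
  finally show ?thesis unfolding c_def using A by simp
qed

theorem theorem2:
  fixes \<epsilon> :: real
  assumes "\<epsilon> > 0"
  shows "\<exists>\<delta>>0. \<exists>N::nat. \<forall>n\<ge>N. \<forall>(A::real set) (B::real set) (\<L>::(real \<times> real) set set).
           finite A \<and> finite B \<and> card A = n \<and> card B = n \<and>
           finite \<L> \<and> (\<forall>L\<in>\<L>. is_line L) \<and>
           real (num_slopes \<L>) \<ge> real n powr \<epsilon> \<and>
           (\<forall>L\<in>\<L>. real (card {M \<in> \<L>. M \<noteq> L \<and> parallel L M}) \<ge> real n powr \<epsilon>)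
           \<longrightarrow> (\<exists>L\<in>\<L>. real (card (L \<inter> (A \<times> B))) < real n powr (1 - \<delta>))"
proof -
  \<comment> \<open>With \<open>\<epsilon> / 2 * j \<ge> 2\<close> the collision bound is of order
    \<open>n powr - 2\<close>, so even after multiplication by \<open>n\<close> it is of order
    \<open>1 / n\<close>.\<close>
  define j where "j = nat \<lceil>4 / \<epsilon>\<rceil>"
  define E where "E = 2 ^ Suc j - (1::nat)"
  \<comment> \<open>The survival side is the power \<open>4 * E\<close> of
    \<open>(n powr - \<delta>) / 4\<close>; this \<open>\<delta>\<close> makes it
    \<open>n powr - (1 / 2)\<close> up to a constant, far above \<open>1 / n\<close>.\<close>
  define \<delta> where "\<delta> = 1 / (8 * real E)"
  have "(1::nat) < 2 ^ Suc j" by (rule one_less_power) simp_all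
  then have "E > 0" unfolding E_def by linarith
  then have \<delta>: "\<delta> > 0" "4 * E * \<delta> = 1 / 2" by (auto simp: \<delta>_def)
  have j: "\<epsilon> / 2 * j \<ge> 2"
  proof -
    have "4 / \<epsilon> \<le> j" unfolding j_def by linarith
    then show ?thesis using assms by (simp add: field_simps)
  qed
  \<comment> \<open>The first entry gives \<open>300 \<le> real n powr \<epsilon>\<close>; the
    second contradicts the final inequality \<open>sqrt n \<le> 30 ^ j * 256 ^ E\<close>, in which
    256 is the fourth power of the 4 dividing \<open>n powr - \<delta>\<close>.\<close>
  define N where "N = nat \<lceil>max (300 powr (1 / \<epsilon>)) ((30 ^ j * 256 ^ E)\<^sup>2 + 1)\<rceil>"
  have contra: False if n: "n \<ge> N" and H: "finite A" "finite B" "card A = n" "card B = n"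
      "finite \<L>" "\<forall>L\<in>\<L>. is_line L" "real (num_slopes \<L>) \<ge> real n powr \<epsilon>"
      "\<forall>L\<in>\<L>. real (card {M \<in> \<L>. M \<noteq> L \<and> parallel L M}) \<ge> real n powr \<epsilon>"
      and rich: "\<forall>L\<in>\<L>. real n powr (1 - \<delta>) \<le> real (card (L \<inter> (A \<times> B)))"
    for n A B and \<L> :: "(real \<times> real) set set"
  proof -
    have "real n \<ge> max (300 powr (1 / \<epsilon>)) ((30 ^ j * 256 ^ E)\<^sup>2 + 1)"
      using n unfolding N_def by linarith
    then have n1: "real n \<ge> 300 powr (1 / \<epsilon>)" and n2: "real n \<ge> (30 ^ j * 256 ^ E)\<^sup>2 + 1" by auto
    have n0: "real n \<ge> 1" using n2 zero_le_power2[of "30 ^ j * 256 ^ E :: real"] by linarith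
    have "300 = (300 powr (1 / \<epsilon>)) powr \<epsilon>" using assms by (simp add: powr_powr)
    also have "\<dots> \<le> real n powr \<epsilon>" using n1 assms by (intro powr_mono2) auto
    finally have "300 \<le> real n powr \<epsilon>" .
    from rich_lines_bound[OF H rich this, of j]
    have "((((real n powr - \<delta>) / 4)\<^sup>2) ^ E)\<^sup>2 \<le> (30 / real n powr (\<epsilon> / 2)) ^ j * n"
      unfolding E_def .
    also have "(30 / real n powr (\<epsilon> / 2)) ^ j * n = 30 ^ j / real n powr (\<epsilon> / 2 * j) * n"
      using n0 by (simp add: power_divide powr_powr flip: powr_realpow)
    also have "\<dots> \<le> 30 ^ j / real n powr 2 * n"
      using j n0 by (intro mult_right_mono divide_left_mono powr_mono mult_pos_pos) auto
    also have "\<dots> = 30 ^ j / n" using n0 by (simp add: power2_eq_square)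
    finally have 1: "((((real n powr - \<delta>) / 4)\<^sup>2) ^ E)\<^sup>2 \<le> 30 ^ j / n" .
    have "((((real n powr - \<delta>) / 4)\<^sup>2) ^ E)\<^sup>2 = (real n powr - \<delta>) ^ (4 * E) / 4 ^ (4 * E)"
    proof -
      have "((y\<^sup>2) ^ E)\<^sup>2 = y ^ (4 * E)" for y :: real
        by (simp only: power_mult[symmetric]) (simp add: mult_ac)
      then show ?thesis by (simp only: power_divide)
    qed
    also have "(real n powr - \<delta>) ^ (4 * E) = real n powr (- (1 / 2))"
    proof -
      have "(real n powr - \<delta>) ^ (4 * E) = real n powr (- \<delta> * real (4 * E))"
        using n0 by (simp add: powr_powr flip: powr_realpow)
      also have "- \<delta> * real (4 * E) = - (1 / 2)" using \<delta>(2) by (simp add: mult_ac)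
      finally show ?thesis .
    qed
    also have "\<dots> = 1 / sqrt n" using n0 by (simp add: powr_minus powr_half_sqrt divide_simps)
    also have "(4::real) ^ (4 * E) = 256 ^ E" by (simp add: power_mult)
    finally have "1 / sqrt n / 256 ^ E \<le> 30 ^ j / n" using 1 by simp
    then have "n / sqrt n \<le> 30 ^ j * 256 ^ E" using n0 by (simp add: field_simps)
    then have "sqrt n \<le> 30 ^ j * 256 ^ E" by (simp add: real_div_sqrt)
    then have "(sqrt n)\<^sup>2 \<le> (30 ^ j * 256 ^ E)\<^sup>2" by (intro power_mono) auto
    then show False using n2 by simp
  qed
  show ?thesis
  proof (intro exI[of _ \<delta>] exI[of _ N] conjI \<delta>(1) allI impI, elim conjE, rule ccontr)
    fix n and A B :: "real set" and \<L> :: "(real \<times> real) set set"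
    assume H: "n \<ge> N" "finite A" "finite B" "card A = n" "card B = n"
      "finite \<L>" "\<forall>L\<in>\<L>. is_line L" "real (num_slopes \<L>) \<ge> real n powr \<epsilon>"
      "\<forall>L\<in>\<L>. real (card {M \<in> \<L>. M \<noteq> L \<and> parallel L M}) \<ge> real n powr \<epsilon>"
    assume "\<not> (\<exists>L\<in>\<L>. real (card (L \<inter> (A \<times> B))) < real n powr (1 - \<delta>))"
    \<comment> \<open>This is vacuous for an empty family, which the lower bound on
      \<open>num_slopes\<close> excludes.\<close>
    then have "\<forall>L\<in>\<L>. real n powr (1 - \<delta>) \<le> real (card (L \<inter> (A \<times> B)))"
      by (meson not_less)
    then show False by (rule contra[OF H])
  qed
qed

end
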